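(* Let $n\ge 3$ be an integer, $\theta\in(0,\pi]$, $f_0>0$, $B\in\mathbb{R}$, $T\subset[-1,\cos\theta]$, $g:T\to\mathbb{R}$, and let $F\in\mathcal{F}(n,f_0,T,g,B,\theta)$. Suppose $a>0$ is such that $g(t)\le -a<0$ for all $t\in T$. Then for every $(N,n,\theta)$ spherical code $C$, $$A(T)\le\frac{2}{N}\lfloor Q\rfloor,\qquad Q:=\frac{F(1,1,1)+3(N-1)B-f_0N^2}{6a},$$ where $A(T)$ is the distance-distribution sum of $C$ over $T$. In particular, if $T=\{t\}$ and $Q<1$, then $A_t=0$.
   Context: Spherical codes. An $(N,n,\theta)$ spherical code is an $N$-element subset $C$ ($N\ge1$) of the unit sphere $\mathbb{S}^{n-1}\subset\mathbb{R}^n$ such that $c\cdot c'\le\cos\theta$ for all distinct $c,c'\in C$. Distance distribution. For $u\in C$ and $-1\le t\le1$ let $A_t(u)=|\{v\in C: v\cdot u=t\}|$ and $A_t=\frac1N\sum_{u\in C}A_t(u)$. For $T\subset[-1,1]$ let $A(T)=\sum_{t\in T:\,A_t>0}A_t$ (a finite sum). Matrices $S_k^n$. Let $P_k^{n-1}$ denote the Gegenbauer polynomial of degree $k$ for dimension $n-1$, i.e. the polynomials orthogonal on $[-1,1]$ with respect to the weight $(1-t^2)^{(n-4)/2}$, normalized by $P_k^{n-1}(1)=1$. Fix $d\ge0$. For $0\le k\le d$ let $Y_k^n(x,y,z)$ be the $(d-k+1)\times(d-k+1)$ matrix with entries, indexed by $0\le i,j\le d-k$, $$\bigl(Y_k^n\bigr)_{ij}(x,y,z)=x^iy^j\bigl((1-x^2)(1-y^2)\bigr)^{k/2}P_k^{n-1}\!\left(\frac{z-xy}{\sqrt{(1-x^2)(1-y^2)}}\right),$$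 (which is a polynomial in $x,y,z$), and let $S_k^n(x,y,z)=\frac16\sum_{\sigma}Y_k^n(\sigma(x,y,z))$, the sum being over all $6$ permutations $\sigma$ of the variables $(x,y,z)$. Write $\langle A,B\rangle=\operatorname{tr}(A^{T}B)$. Class $\mathrm{BV}(n,f_0)$. For $f_0>0$, $\mathrm{BV}(n,f_0)$ is the class of symmetric real polynomials $F(x,y,z)$ that can be written (for some $d$) as $F(x,y,z)=\sum_{k=0}^d\langle M_k,S_k^n(x,y,z)\rangle$ with all $M_k$ real symmetric positive semidefinite and $M_0-f_0E_0$ positive semidefinite, where $E_0$ is the matrix whose only nonzero entry is a $1$ in the top left corner (index $(0,0)$). Class $\mathcal{F}$. For $g:T\to\mathbb{R}$ with $T\subset[-1,1)$, put $g_T(x)=g(x)$ if $x\in T$ and $g_T(x)=0$ otherwise. Let $$D(\theta)=\{(x,y,z): -1\le x,y,z\le\cos\theta,\ 1+2xyz-x^2-y^2-z^2\ge0\}.$$ $\mathcal{F}(n,f_0,T,g,B,\theta)$ is the class of symmetric polynomials $F(x,y,z)$ such that: (1) $F\in\mathrm{BV}(n,f_0)$; (2) $F(x,x,1)\le B+2g_T(x)$ for all $x\in[-1,\cos\theta]$; (3) $F(x,y,z)\le g_T(x)+g_T(y)+g_T(z)$ for all $(x,y,z)\in D(\theta)$. *)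

theory Defs
  imports "HOL-Analysis.Analysis" "HOL-Computational_Algebra.Polynomial"
begin

section \<open>Spherical codes and their distance distribution\<close>

definition spherical_code :: "nat \<Rightarrow> real \<Rightarrow> (real ^ 'n) set \<Rightarrow> bool" where
  "spherical_code N \<theta> C \<longleftrightarrow>
     N \<ge> 1 \<and> finite C \<and> card C = N \<and> C \<subseteq> sphere 0 1 \<and>
     (\<forall>c\<in>C. \<forall>c'\<in>C. c \<noteq> c' \<longrightarrow> c \<bullet> c' \<le> cos \<theta>)"

definition dist_at :: "(real ^ 'n) set \<Rightarrow> real ^ 'n \<Rightarrow> real \<Rightarrow> nat" where
  "dist_at C u t = card {v \<in> C. v \<bullet> u = t}"

definition dist_distr :: "(real ^ 'n) set \<Rightarrow> real \<Rightarrow> real" where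
  "dist_distr C t = (1 / real (card C)) * (\<Sum>u\<in>C. real (dist_at C u t))"

definition dist_distr_set :: "(real ^ 'n) set \<Rightarrow> real set \<Rightarrow> real" where
  "dist_distr_set C T = (\<Sum>t\<in>{t \<in> T. dist_distr C t > 0}. dist_distr C t)"

section \<open>Gegenbauer polynomials\<close>

text \<open>
  The polynomials for dimension \<open>m\<close> are orthogonal with respect to \<open>(1 - t^2)^((m - 3)/2)\<close>,
  which for \<open>m = n - 1\<close> is the weight \<open>(1 - t^2)^((n - 4)/2)\<close>. The weight is integrable, and the
  family exists and is unique, for \<open>m \<ge> 2\<close>; the definition is only meaningful in that range.
\<close>

definition gegenbauer_family :: "nat \<Rightarrow> (nat \<Rightarrow> real poly) \<Rightarrow> bool" where
  "gegenbauer_family m P \<longleftrightarrow>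
     (\<forall>k. degree (P k) = k \<and> poly (P k) 1 = 1) \<and>
     (\<forall>i j. i \<noteq> j \<longrightarrow>
        integral {-1..1}
          (\<lambda>t. poly (P i) t * poly (P j) t * (1 - t\<^sup>2) powr ((real m - 3) / 2)) = 0)"

definition gegenbauer :: "nat \<Rightarrow> nat \<Rightarrow> real poly" where
  "gegenbauer m = (THE P. gegenbauer_family m P)"

section \<open>The matrices \<open>Y\<close> and \<open>S\<close>\<close>

text \<open>
  The formula for the entries of \<open>Y\<close> is literally meaningful for \<open>\<bar>x\<bar>, \<bar>y\<bar> < 1\<close>, where
  it agrees with a unique polynomial function of \<open>(x, y, z)\<close> (\<open>P k\<close> has the parity of \<open>k\<close>, so no
  roots survive). That polynomial, on all of \<open>\<real>\<^sup>3\<close>, is the entry. The values at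
  \<open>x\<^sup>2 = 1\<close> or \<open>y\<^sup>2 = 1\<close> matter, e.g. for \<open>F(x,x,1)\<close>.
\<close>

definition Y_mat :: "nat \<Rightarrow> nat \<Rightarrow> real \<Rightarrow> real \<Rightarrow> real \<Rightarrow> nat \<Rightarrow> nat \<Rightarrow> real" where
  "Y_mat n k x y z i j =
     (THE f :: real \<Rightarrow> real \<Rightarrow> real \<Rightarrow> real.
        real_polynomial_function (\<lambda>(x, y, z). f x y z) \<and>
        (\<forall>x y z. \<bar>x\<bar> < 1 \<and> \<bar>y\<bar> < 1 \<longrightarrow>
           f x y z = x ^ i * y ^ j * ((1 - x\<^sup>2) * (1 - y\<^sup>2)) powr (real k / 2)
             * poly (gegenbauer (n - 1) k)
                 ((z - x * y) / sqrt ((1 - x\<^sup>2) * (1 - y\<^sup>2))))) x y z"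

definition S_mat :: "nat \<Rightarrow> nat \<Rightarrow> real \<Rightarrow> real \<Rightarrow> real \<Rightarrow> nat \<Rightarrow> nat \<Rightarrow> real" where
  "S_mat n k x y z i j = (1 / 6) *
     (Y_mat n k x y z i j + Y_mat n k x z y i j + Y_mat n k y x z i j +
      Y_mat n k y z x i j + Y_mat n k z x y i j + Y_mat n k z y x i j)"

text \<open>
  An \<open>s \<times> s\<close> matrix is represented by a function of two indices, of which only the values at
  indices \<open>< s\<close> are used; \<open>mat_inner s A B\<close> is the trace of \<open>A\<^sup>T B\<close>.
\<close>

definition mat_inner ::
  "nat \<Rightarrow> (nat \<Rightarrow> nat \<Rightarrow> real) \<Rightarrow> (nat \<Rightarrow> nat \<Rightarrow> real) \<Rightarrow> real" where
  "mat_inner s A B = (\<Sum>j<s. \<Sum>i<s. A i j * B i j)"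

definition psd :: "nat \<Rightarrow> (nat \<Rightarrow> nat \<Rightarrow> real) \<Rightarrow> bool" where
  "psd s A \<longleftrightarrow> (\<forall>i<s. \<forall>j<s. A i j = A j i) \<and>
     (\<forall>v :: nat \<Rightarrow> real. (\<Sum>i<s. \<Sum>j<s. v i * A i j * v j) \<ge> 0)"

definition E0 :: "nat \<Rightarrow> nat \<Rightarrow> real" where
  "E0 i j = (if i = 0 \<and> j = 0 then 1 else 0)"

section \<open>The classes \<open>BV\<close> and \<open>\<F>\<close>\<close>

definition symmetric_polynomial3 :: "(real \<Rightarrow> real \<Rightarrow> real \<Rightarrow> real) \<Rightarrow> bool" where
  "symmetric_polynomial3 F \<longleftrightarrow>
     real_polynomial_function (\<lambda>(x, y, z). F x y z) \<and>
     (\<forall>x y z. F x z y = F x y z \<and> F y x z = F x y z \<and> F y z x = F x y z \<and>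
              F z x y = F x y z \<and> F z y x = F x y z)"

definition BV :: "nat \<Rightarrow> real \<Rightarrow> (real \<Rightarrow> real \<Rightarrow> real \<Rightarrow> real) set" where
  "BV n f0 = {F. symmetric_polynomial3 F \<and>
     (\<exists>d :: nat. \<exists>M :: nat \<Rightarrow> nat \<Rightarrow> nat \<Rightarrow> real.
        (\<forall>k\<le>d. psd (d - k + 1) (M k)) \<and>
        psd (d + 1) (\<lambda>i j. M 0 i j - f0 * E0 i j) \<and>
        (\<forall>x y z. F x y z = (\<Sum>k\<le>d. mat_inner (d - k + 1) (M k) (S_mat n k x y z))))}"

definition extend_zero :: "real set \<Rightarrow> (real \<Rightarrow> real) \<Rightarrow> real \<Rightarrow> real" where
  "extend_zero T g x = (if x \<in> T then g x else 0)"

definition D_region :: "real \<Rightarrow> (real \<times> real \<times> real) set" where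
  "D_region \<theta> = {(x, y, z).
     -1 \<le> x \<and> x \<le> cos \<theta> \<and> -1 \<le> y \<and> y \<le> cos \<theta> \<and> -1 \<le> z \<and> z \<le> cos \<theta> \<and>
     1 + 2 * x * y * z - x\<^sup>2 - y\<^sup>2 - z\<^sup>2 \<ge> 0}"

definition F_class ::
  "nat \<Rightarrow> real \<Rightarrow> real set \<Rightarrow> (real \<Rightarrow> real) \<Rightarrow> real \<Rightarrow> real \<Rightarrow>
     (real \<Rightarrow> real \<Rightarrow> real \<Rightarrow> real) set" where
  "F_class n f0 T g B \<theta> = {F \<in> BV n f0.
     (\<forall>x\<in>{-1..cos \<theta>}. F x x 1 \<le> B + 2 * extend_zero T g x) \<and>
     (\<forall>(x, y, z)\<in>D_region \<theta>.
        F x y z \<le> extend_zero T g x + extend_zero T g y + extend_zero T g z)}"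

end

theory Submission
  imports Defs
begin

text \<open>
  Summing \<open>F(u\<bullet>w, v\<bullet>w, u\<bullet>v)\<close> over \<open>C\<^sup>3\<close> gives at least \<open>f\<^sub>0 N\<^sup>3\<close>: for fixed \<open>w\<close>, the argument of
  \<open>P\<^sub>k\<close> in \<open>Y\<^sub>k\<close> is the cosine of the angle between the projections of \<open>u\<close> and \<open>v\<close> to the hyperplane
  orthogonal to \<open>w\<close>, and \<open>P\<^sub>k\<close> is a positive definite kernel in dimension \<open>n - 1\<close> (Schoenberg).
  On the other hand the conditions on \<open>F\<close> bound the sum above by
  \<open>N F(1,1,1) + 3 N (N - 1) B + 3 N \<Sum> g\<^sub>T(u\<bullet>v)\<close>, and \<open>\<Sum> g\<^sub>T(u\<bullet>v) \<le> - a N A(T)\<close>, where \<open>N A(T)\<close> is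
  an even integer because it counts ordered pairs of distinct points.

  Positive definiteness is proved algebraically: the zonal polynomials \<open>\<bar>x\<bar>\<^sup>k\<bar>u\<bar>\<^sup>k P\<^sub>k(cos \<angle>(x,u))\<close>,
  built from the three-term recurrence, are harmonic, and the Fischer inner product of two of them is
  a positive multiple of the kernel.
\<close>

section \<open>Zonal harmonics and the Fischer inner product\<close>

text \<open>
  A polynomial in the variables indexed by \<open>'i\<close> is represented by its coefficient function, which
  maps a multi-index \<open>\<alpha> :: 'i \<Rightarrow> nat\<close> to the coefficient of the monomial with exponents \<open>\<alpha>\<close>.
\<close>

definition mult_var :: "'i \<Rightarrow> (('i \<Rightarrow> nat) \<Rightarrow> real) \<Rightarrow> ('i \<Rightarrow> nat) \<Rightarrow> real" where
  "mult_var i p = (\<lambda>\<alpha>. if \<alpha> i = 0 then 0 else p (\<alpha>(i := \<alpha> i - 1)))"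

definition deriv_var :: "'i \<Rightarrow> (('i \<Rightarrow> nat) \<Rightarrow> real) \<Rightarrow> ('i \<Rightarrow> nat) \<Rightarrow> real" where
  "deriv_var i p = (\<lambda>\<alpha>. real (\<alpha> i + 1) * p (\<alpha>(i := \<alpha> i + 1)))"

text \<open>The canonical commutation relation \<open>[\<partial>_i, x_j] = \<delta>_ij\<close>; the
  commutators with linear forms, \<open>|x|^2\<close> and the Laplacian below are all sums of
  instances of it.\<close>

lemma deriv_mult_var:
  "deriv_var i (mult_var j p) \<alpha> = mult_var j (deriv_var i p) \<alpha> + (if i = j then p \<alpha> else 0)"
proof (cases "i = j")
  case True
  then show ?thesis
    by (cases "\<alpha> j") (auto simp: deriv_var_def mult_var_def algebra_simps fun_upd_idem)
next
  case False
  then show ?thesis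
    by (auto simp: deriv_var_def mult_var_def fun_upd_twist)
qed

lemma deriv_var_commute: "deriv_var i (deriv_var j p) \<alpha> = deriv_var j (deriv_var i p) \<alpha>"
  by (cases "i = j") (auto simp: deriv_var_def fun_upd_twist)

lemma mult_var_linear:
  "mult_var i (\<lambda>\<alpha>. p \<alpha> + q \<alpha>) \<alpha> = mult_var i p \<alpha> + mult_var i q \<alpha>"
  "mult_var i (\<lambda>\<alpha>. p \<alpha> - q \<alpha>) \<alpha> = mult_var i p \<alpha> - mult_var i q \<alpha>"
  "mult_var i (\<lambda>\<alpha>. c * p \<alpha>) \<alpha> = c * mult_var i p \<alpha>"
  "mult_var i (\<lambda>\<alpha>. \<Sum>j\<in>A. f j \<alpha>) \<alpha> = (\<Sum>j\<in>A. mult_var i (f j) \<alpha>)"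
  "mult_var i (\<lambda>\<alpha>. 0) \<alpha> = 0"
  by (auto simp: mult_var_def)

lemma deriv_var_linear:
  "deriv_var i (\<lambda>\<alpha>. p \<alpha> + q \<alpha>) \<alpha> = deriv_var i p \<alpha> + deriv_var i q \<alpha>"
  "deriv_var i (\<lambda>\<alpha>. p \<alpha> - q \<alpha>) \<alpha> = deriv_var i p \<alpha> - deriv_var i q \<alpha>"
  "deriv_var i (\<lambda>\<alpha>. c * p \<alpha>) \<alpha> = c * deriv_var i p \<alpha>"
  "deriv_var i (\<lambda>\<alpha>. \<Sum>j\<in>A. f j \<alpha>) \<alpha> = (\<Sum>j\<in>A. deriv_var i (f j) \<alpha>)"
  "deriv_var i (\<lambda>\<alpha>. 0) \<alpha> = 0"
  by (auto simp: deriv_var_def algebra_simps sum_distrib_left)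

text \<open>The constant polynomial 1, from which the zonal polynomials are generated.\<close>

definition vacuum :: "('i \<Rightarrow> nat) \<Rightarrow> real" where
  "vacuum \<alpha> = (if \<alpha> = (\<lambda>_. 0) then 1 else 0)"

lemma deriv_var_vacuum [simp]: "deriv_var i vacuum \<alpha> = 0"
  by (auto simp: deriv_var_def vacuum_def fun_eq_iff)

lemma mult_var_at_zero [simp]: "mult_var i p (\<lambda>_. 0) = 0"
  by (simp add: mult_var_def)

text \<open>
  The homogenised Gegenbauer polynomial \<open>q\<^bsup>k/2\<^esup> P\<^sub>k(s / \<surd>q)\<close> for dimension \<open>m\<close>, given by the three-term
  recurrence of \<open>P\<^sub>k\<close> normalised by \<open>P\<^sub>k(1) = 1\<close>; only even powers of \<open>\<surd>q\<close> occur.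
\<close>

fun bi_geg :: "nat \<Rightarrow> nat \<Rightarrow> real \<Rightarrow> real \<Rightarrow> real" where
  "bi_geg m 0 s q = 1"
| "bi_geg m (Suc 0) s q = s"
| "bi_geg m (Suc (Suc k)) s q =
     (2 * real k + real m) / (real k + real m - 1) * s * bi_geg m (Suc k) s q - (real k + 1) / (real k + real m - 1) * q * bi_geg m k s q"

section \<open>Directional derivative and Laplacian, and their commutators with
  multiplications\<close>

locale variables =
  fixes I :: "'i set"
  assumes finite_I [simp]: "finite I"
begin

definition dot :: "('i \<Rightarrow> real) \<Rightarrow> ('i \<Rightarrow> real) \<Rightarrow> real" where
  "dot u v = (\<Sum>i\<in>I. u i * v i)"

definition mult_lin :: "('i \<Rightarrow> real) \<Rightarrow> (('i \<Rightarrow> nat) \<Rightarrow> real) \<Rightarrow> ('i \<Rightarrow> nat) \<Rightarrow> real" where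
  "mult_lin u p = (\<lambda>\<alpha>. \<Sum>i\<in>I. u i * mult_var i p \<alpha>)"

definition dir_deriv :: "('i \<Rightarrow> real) \<Rightarrow> (('i \<Rightarrow> nat) \<Rightarrow> real) \<Rightarrow> ('i \<Rightarrow> nat) \<Rightarrow> real" where
  "dir_deriv u p = (\<lambda>\<alpha>. \<Sum>i\<in>I. u i * deriv_var i p \<alpha>)"

definition mult_sq :: "(('i \<Rightarrow> nat) \<Rightarrow> real) \<Rightarrow> ('i \<Rightarrow> nat) \<Rightarrow> real" where
  "mult_sq p = (\<lambda>\<alpha>. \<Sum>i\<in>I. mult_var i (mult_var i p) \<alpha>)"

definition laplace :: "(('i \<Rightarrow> nat) \<Rightarrow> real) \<Rightarrow> ('i \<Rightarrow> nat) \<Rightarrow> real" where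
  "laplace p = (\<lambda>\<alpha>. \<Sum>i\<in>I. deriv_var i (deriv_var i p) \<alpha>)"

definition homogeneous :: "nat \<Rightarrow> (('i \<Rightarrow> nat) \<Rightarrow> real) \<Rightarrow> bool" where
  "homogeneous k p \<longleftrightarrow> (\<forall>\<alpha>. p \<alpha> \<noteq> 0 \<longrightarrow> sum \<alpha> I = k)"

lemmas op_defs = mult_lin_def dir_deriv_def mult_sq_def laplace_def

lemma op_linear:
  "mult_lin u (\<lambda>\<alpha>. p \<alpha> + q \<alpha>) \<alpha> = mult_lin u p \<alpha> + mult_lin u q \<alpha>"
  "mult_lin u (\<lambda>\<alpha>. p \<alpha> - q \<alpha>) \<alpha> = mult_lin u p \<alpha> - mult_lin u q \<alpha>"
  "mult_lin u (\<lambda>\<alpha>. c * p \<alpha>) \<alpha> = c * mult_lin u p \<alpha>"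
  "mult_lin u (\<lambda>\<alpha>. 0) \<alpha> = 0"
  "dir_deriv u (\<lambda>\<alpha>. p \<alpha> + q \<alpha>) \<alpha> = dir_deriv u p \<alpha> + dir_deriv u q \<alpha>"
  "dir_deriv u (\<lambda>\<alpha>. p \<alpha> - q \<alpha>) \<alpha> = dir_deriv u p \<alpha> - dir_deriv u q \<alpha>"
  "dir_deriv u (\<lambda>\<alpha>. c * p \<alpha>) \<alpha> = c * dir_deriv u p \<alpha>"
  "dir_deriv u (\<lambda>\<alpha>. 0) \<alpha> = 0"
  "mult_sq (\<lambda>\<alpha>. p \<alpha> + q \<alpha>) \<alpha> = mult_sq p \<alpha> + mult_sq q \<alpha>"
  "mult_sq (\<lambda>\<alpha>. p \<alpha> - q \<alpha>) \<alpha> = mult_sq p \<alpha> - mult_sq q \<alpha>"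
  "mult_sq (\<lambda>\<alpha>. c * p \<alpha>) \<alpha> = c * mult_sq p \<alpha>"
  "mult_sq (\<lambda>\<alpha>. 0) \<alpha> = 0"
  "laplace (\<lambda>\<alpha>. p \<alpha> + q \<alpha>) \<alpha> = laplace p \<alpha> + laplace q \<alpha>"
  "laplace (\<lambda>\<alpha>. p \<alpha> - q \<alpha>) \<alpha> = laplace p \<alpha> - laplace q \<alpha>"
  "laplace (\<lambda>\<alpha>. c * p \<alpha>) \<alpha> = c * laplace p \<alpha>"
  "laplace (\<lambda>\<alpha>. 0) \<alpha> = 0"
  by (simp_all add: op_defs mult_var_linear[abs_def] deriv_var_linear[abs_def] algebra_simps
      sum.distrib sum_subtractf sum_distrib_left)

lemma dir_deriv_mult_lin:
  "dir_deriv v (mult_lin u p) \<alpha> = mult_lin u (dir_deriv v p) \<alpha> + dot u v * p \<alpha>"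
proof -
  have "dir_deriv v (mult_lin u p) \<alpha>
      = (\<Sum>i\<in>I. \<Sum>j\<in>I. v i * u j * mult_var j (deriv_var i p) \<alpha>)
        + (\<Sum>i\<in>I. \<Sum>j\<in>I. if i = j then v i * u j * p \<alpha> else 0)"
    unfolding op_defs deriv_var_linear sum_distrib_left sum.distrib [symmetric]
    by (intro sum.cong refl) (auto simp: deriv_mult_var algebra_simps)
  also have "(\<Sum>i\<in>I. \<Sum>j\<in>I. if i = j then v i * u j * p \<alpha> else 0) = dot u v * p \<alpha>"
    by (simp add: dot_def sum_distrib_left mult_ac)
  also have "(\<Sum>i\<in>I. \<Sum>j\<in>I. v i * u j * mult_var j (deriv_var i p) \<alpha>)
      = mult_lin u (dir_deriv v p) \<alpha>"
    by (subst sum.swap) (simp add: op_defs mult_var_linear sum_distrib_left mult_ac)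
  finally show ?thesis .
qed

lemma dir_deriv_mult_sq:
  "dir_deriv v (mult_sq p) \<alpha> = mult_sq (dir_deriv v p) \<alpha> + 2 * mult_lin v p \<alpha>"
proof -
  have *: "deriv_var i (mult_var j (mult_var j p)) \<alpha>
      = mult_var j (mult_var j (deriv_var i p)) \<alpha> + (if i = j then 2 * mult_var j p \<alpha> else 0)" for i j
  proof -
    have "deriv_var i (mult_var j p) = (\<lambda>\<alpha>. mult_var j (deriv_var i p) \<alpha> + (if i = j then p \<alpha> else 0))"
      by (simp add: fun_eq_iff deriv_mult_var)
    then show ?thesis
      by (cases "i = j") (simp_all add: deriv_mult_var mult_var_linear)
  qed
  have "dir_deriv v (mult_sq p) \<alpha>
      = (\<Sum>i\<in>I. \<Sum>j\<in>I. v i * mult_var j (mult_var j (deriv_var i p)) \<alpha>)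
        + (\<Sum>i\<in>I. \<Sum>j\<in>I. if i = j then v i * 2 * mult_var j p \<alpha> else 0)"
    unfolding op_defs deriv_var_linear sum_distrib_left sum.distrib [symmetric]
    by (intro sum.cong refl) (auto simp: * algebra_simps)
  also have "(\<Sum>i\<in>I. \<Sum>j\<in>I. if i = j then v i * 2 * mult_var j p \<alpha> else 0) = 2 * mult_lin v p \<alpha>"
    by (simp add: mult_lin_def sum_distrib_left mult_ac)
  also have "(\<Sum>i\<in>I. \<Sum>j\<in>I. v i * mult_var j (mult_var j (deriv_var i p)) \<alpha>)
      = mult_sq (dir_deriv v p) \<alpha>"
    by (subst sum.swap) (simp add: op_defs mult_var_linear[abs_def] sum_distrib_left mult_ac)
  finally show ?thesis .
qed

lemma laplace_mult_lin:
  "laplace (mult_lin u p) \<alpha> = mult_lin u (laplace p) \<alpha> + 2 * dir_deriv u p \<alpha>"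
proof -
  have *: "deriv_var i (deriv_var i (mult_var j p)) \<alpha>
      = mult_var j (deriv_var i (deriv_var i p)) \<alpha> + (if i = j then 2 * deriv_var j p \<alpha> else 0)" for i j
  proof -
    have "deriv_var i (mult_var j p) = (\<lambda>\<alpha>. mult_var j (deriv_var i p) \<alpha> + (if i = j then p \<alpha> else 0))"
      by (simp add: fun_eq_iff deriv_mult_var)
    then show ?thesis
      by (cases "i = j") (simp_all add: deriv_mult_var deriv_var_linear)
  qed
  have "laplace (mult_lin u p) \<alpha>
      = (\<Sum>i\<in>I. \<Sum>j\<in>I. u j * mult_var j (deriv_var i (deriv_var i p)) \<alpha>)
        + (\<Sum>i\<in>I. \<Sum>j\<in>I. if i = j then u j * 2 * deriv_var j p \<alpha> else 0)"
    unfolding op_defs deriv_var_linear[abs_def] sum_distrib_left sum.distrib [symmetric]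
    by (intro sum.cong refl) (auto simp: * algebra_simps)
  also have "(\<Sum>i\<in>I. \<Sum>j\<in>I. if i = j then u j * 2 * deriv_var j p \<alpha> else 0) = 2 * dir_deriv u p \<alpha>"
    by (simp add: dir_deriv_def sum_distrib_left mult_ac)
  also have "(\<Sum>i\<in>I. \<Sum>j\<in>I. u j * mult_var j (deriv_var i (deriv_var i p)) \<alpha>)
      = mult_lin u (laplace p) \<alpha>"
    by (subst sum.swap) (simp add: op_defs mult_var_linear sum_distrib_left mult_ac)
  finally show ?thesis .
qed

text \<open>The commutator is four times the Euler operator plus twice the dimension. The Euler
  operator is diagonal on monomials, so at \<open>\<alpha>\<close> it is the scalar
  \<open>sum \<alpha> I\<close>.\<close>

lemma laplace_mult_sq:
  "laplace (mult_sq p) \<alpha> = mult_sq (laplace p) \<alpha> + (4 * real (sum \<alpha> I) + 2 * real (card I)) * p \<alpha>"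
proof -
  have euler: "mult_var j (deriv_var j q) \<beta> = real (\<beta> j) * q \<beta>" for j \<beta> and q :: "('i \<Rightarrow> nat) \<Rightarrow> real"
    by (auto simp: mult_var_def deriv_var_def)
  have *: "deriv_var i (deriv_var i (mult_var j (mult_var j p))) \<alpha>
      = mult_var j (mult_var j (deriv_var i (deriv_var i p))) \<alpha>
        + (if i = j then (4 * real (\<alpha> j) + 2) * p \<alpha> else 0)" for i j
  proof -
    have 1: "deriv_var i (mult_var j q) = (\<lambda>\<alpha>. mult_var j (deriv_var i q) \<alpha> + (if i = j then q \<alpha> else 0))" for i j q
      by (simp add: fun_eq_iff deriv_mult_var)
    \<comment> \<open>At exponents 0 and 1 both sides vanish; the nested case split isolates them
      because the subtraction of exponents is truncated.\<close>
    have 2: "mult_var j (mult_var j (deriv_var j (deriv_var j p))) \<alpha> = real (\<alpha> j) * (real (\<alpha> j) - 1) * p \<alpha>" for j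
      by (cases "\<alpha> j"; cases "\<alpha> j - 1")
        (auto simp: mult_var_def deriv_var_def algebra_simps fun_upd_idem)
    show ?thesis
      by (cases "i = j") (simp_all add: 1 2 deriv_var_linear mult_var_linear[abs_def] euler algebra_simps)
  qed
  have "laplace (mult_sq p) \<alpha>
      = (\<Sum>i\<in>I. \<Sum>j\<in>I. mult_var j (mult_var j (deriv_var i (deriv_var i p))) \<alpha>)
        + (\<Sum>i\<in>I. \<Sum>j\<in>I. if i = j then (4 * real (\<alpha> j) + 2) * p \<alpha> else 0)"
    by (simp add: op_defs deriv_var_linear[abs_def] * sum.distrib)
  also have "(\<Sum>i\<in>I. \<Sum>j\<in>I. if i = j then (4 * real (\<alpha> j) + 2) * p \<alpha> else 0)
      = (4 * real (sum \<alpha> I) + 2 * real (card I)) * p \<alpha>"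
    by (simp add: sum_distrib_left sum_distrib_right sum.distrib algebra_simps)
  also have "(\<Sum>i\<in>I. \<Sum>j\<in>I. mult_var j (mult_var j (deriv_var i (deriv_var i p))) \<alpha>)
      = mult_sq (laplace p) \<alpha>"
    by (subst sum.swap) (simp add: op_defs mult_var_linear[abs_def])
  finally show ?thesis .
qed

lemma laplace_dir_deriv: "laplace (dir_deriv u p) \<alpha> = dir_deriv u (laplace p) \<alpha>"
proof -
  have "deriv_var i (deriv_var i (deriv_var j p)) \<alpha> = deriv_var j (deriv_var i (deriv_var i p)) \<alpha>" for i j
    by (metis deriv_var_commute ext)
  then show ?thesis
    unfolding op_defs deriv_var_linear[abs_def] sum_distrib_left
    by (subst sum.swap) simp
qed

section \<open>Zonal polynomials: homogeneity and harmonicity\<close>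

lemma homogeneous_mult_lin:
  assumes "homogeneous k p"
  shows "homogeneous (Suc k) (mult_lin u p)"
  unfolding homogeneous_def
proof (intro allI impI)
  fix \<alpha> assume "mult_lin u p \<alpha> \<noteq> 0"
  then obtain i where i: "i \<in> I" "mult_var i p \<alpha> \<noteq> 0"
    unfolding mult_lin_def by (metis (no_types, lifting) mult_zero_right sum.not_neutral_contains_not_neutral)
  then have "\<alpha> i > 0" "p (\<alpha>(i := \<alpha> i - 1)) \<noteq> 0"
    by (auto simp: mult_var_def split: if_splits)
  then have "sum (\<alpha>(i := \<alpha> i - 1)) I = k"
    using assms unfolding homogeneous_def by blast
  moreover have "sum (\<alpha>(i := \<alpha> i - 1)) I = \<alpha> i - 1 + sum \<alpha> (I - {i})"
    using i by (subst sum.remove[of I i]) auto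
  moreover have "sum \<alpha> I = \<alpha> i + sum \<alpha> (I - {i})"
    using i by (subst sum.remove[of I i]) auto
  ultimately show "sum \<alpha> I = Suc k" using \<open>\<alpha> i > 0\<close> by simp
qed

lemma homogeneous_mult_sq:
  assumes "homogeneous k p"
  shows "homogeneous (Suc (Suc k)) (mult_sq p)"
  unfolding homogeneous_def
proof (intro allI impI)
  fix \<alpha> assume "mult_sq p \<alpha> \<noteq> 0"
  then obtain i where i: "i \<in> I" "mult_var i (mult_var i p) \<alpha> \<noteq> 0"
    unfolding mult_sq_def by (metis (no_types, lifting) sum.not_neutral_contains_not_neutral)
  \<comment> \<open>A single variable is the linear form of a unit vector, so the lemma on linear
    forms applies twice.\<close>
  have single: "mult_var i q = mult_lin (\<lambda>j. if j = i then 1 else 0) q" for q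
    using i(1) by (auto simp: mult_lin_def fun_eq_iff if_distrib[of "\<lambda>x. x * _"] cong: if_cong)
  have "homogeneous (Suc (Suc k)) (mult_var i (mult_var i p))"
    unfolding single by (intro homogeneous_mult_lin assms)
  with i show "sum \<alpha> I = Suc (Suc k)" by (simp add: homogeneous_def)
qed

text \<open>\<open>zonal k u\<close> represents the polynomial \<open>x \<mapsto> bi_geg (card I) k (u \<bullet> x) (\<bar>u\<bar>\<^sup>2 \<bar>x\<bar>\<^sup>2)\<close>.\<close>

fun zonal :: "nat \<Rightarrow> ('i \<Rightarrow> real) \<Rightarrow> ('i \<Rightarrow> nat) \<Rightarrow> real" where
  "zonal 0 u = vacuum"
| "zonal (Suc 0) u = mult_lin u vacuum"
| "zonal (Suc (Suc k)) u = (\<lambda>\<alpha>.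
     (2 * real k + real (card I)) / (real k + real (card I) - 1) * mult_lin u (zonal (Suc k) u) \<alpha>
     - (real k + 1) / (real k + real (card I) - 1) * dot u u * mult_sq (zonal k u) \<alpha>)"

lemma homogeneous_zonal: "homogeneous k (zonal k u)"
proof (induction k rule: induct_nat_012)
  case 0
  then show ?case by (auto simp: homogeneous_def vacuum_def)
next
  case 1
  have "homogeneous 0 (vacuum :: ('i \<Rightarrow> nat) \<Rightarrow> real)"
    by (auto simp: homogeneous_def vacuum_def)
  then show ?case by (auto intro: homogeneous_mult_lin)
next
  case (ge2 k)
  then show ?case
    using homogeneous_mult_lin[OF ge2(2), of u] homogeneous_mult_sq[OF ge2(1)]
    unfolding homogeneous_def by (metis (no_types, lifting) diff_self mult_zero_right zonal.simps(3))
qed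

text \<open>The derivative identity is what makes the next zonal element harmonic.\<close>

lemma dir_deriv_zonal:
  assumes "card I \<ge> 2"
  shows "dir_deriv u (zonal (Suc k) u) \<alpha> = real (Suc k) * dot u u * zonal k u \<alpha>"
proof (induction k arbitrary: \<alpha> rule: induct_nat_012)
  case 0
  have "dir_deriv u vacuum = (\<lambda>\<alpha>. 0)" by (simp add: dir_deriv_def fun_eq_iff)
  then show ?case by (simp add: dir_deriv_mult_lin op_linear)
next
  case 1
  have *: "dir_deriv u vacuum = (\<lambda>\<alpha>. 0)" by (simp add: dir_deriv_def fun_eq_iff)
  have **: "dir_deriv u (mult_lin u vacuum) = (\<lambda>\<alpha>. dot u u * vacuum \<alpha>)"
    by (simp add: fun_eq_iff dir_deriv_mult_lin op_linear *)
  define c where "c = real (card I)"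
  have c: "c \<ge> 2" using assms by (simp add: c_def)
  have "zonal (Suc (Suc 0)) u = (\<lambda>\<alpha>. c / (c - 1) * mult_lin u (mult_lin u vacuum) \<alpha>
      - 1 / (c - 1) * dot u u * mult_sq vacuum \<alpha>)"
    using assms by (simp add: c_def of_nat_diff)
  then have "dir_deriv u (zonal (Suc (Suc 0)) u) \<alpha>
      = c / (c - 1) * (2 * dot u u * mult_lin u vacuum \<alpha>)
      - 1 / (c - 1) * dot u u * (2 * mult_lin u vacuum \<alpha>)"
    by (simp only: op_linear dir_deriv_mult_lin dir_deriv_mult_sq * **) (simp add: algebra_simps)
  also have "\<dots> = 2 * dot u u * mult_lin u vacuum \<alpha>"
    using c by (simp add: divide_simps) (simp add: algebra_simps)
  finally show ?case by simp
next
  case (ge2 k)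
  define m where "m = real (card I)"
  have m: "m \<ge> 2" using assms by (simp add: m_def)
  have IH: "dir_deriv u (zonal (Suc k) u) = (\<lambda>\<alpha>. real (Suc k) * dot u u * zonal k u \<alpha>)"
    "dir_deriv u (zonal (Suc (Suc k)) u) = (\<lambda>\<alpha>. real (Suc (Suc k)) * dot u u * zonal (Suc k) u \<alpha>)"
    using ge2 by (simp_all add: fun_eq_iff del: zonal.simps)
  define Z where "Z = zonal (Suc (Suc k)) u \<alpha>"
  define L where "L = mult_lin u (zonal (Suc k) u) \<alpha>"
  define S where "S = mult_sq (zonal k u) \<alpha>"
  define q where "q = dot u u"
  \<comment> \<open>The recurrence without denominators: it turns the combination of
    \<open>L\<close> and \<open>S\<close> that arises below back into a multiple of
    \<open>Z\<close>.\<close>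
  have rec: "(k + m - 1) * Z = (2 * k + m) * L - (k + 1) * q * S"
  proof -
    have "Z = (2 * k + m) / (k + m - 1) * L - (k + 1) / (k + m - 1) * q * S"
      by (simp add: Z_def L_def S_def q_def m_def)
    then show ?thesis
      using m by (simp add: divide_simps) (simp add: algebra_simps)
  qed
  have "zonal (Suc (Suc (Suc k))) u = (\<lambda>\<alpha>. (2 * (k + 1) + m) / (k + m) * mult_lin u (zonal (Suc (Suc k)) u) \<alpha>
     - (k + 2) / (k + m) * q * mult_sq (zonal (Suc k) u) \<alpha>)"
    by (simp add: m_def q_def algebra_simps)
  then have "dir_deriv u (zonal (Suc (Suc (Suc k))) u) \<alpha>
    = (2 * (k + 1) + m) / (k + m) * (real (Suc (Suc k)) * q * L + q * Z)
      - (k + 2) / (k + m) * q * (real (Suc k) * q * S + 2 * L)"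
    by (simp only: op_linear dir_deriv_mult_lin dir_deriv_mult_sq IH q_def L_def S_def Z_def mult.assoc)
  \<comment> \<open>The \<open>L\<close> terms combine by
    \<open>(2(k+1)+m)(k+2) - 2(k+2) = (k+2)(2k+m)\<close>, which makes the bracket the right-hand
    side of \<open>rec\<close>.\<close>
  also have "\<dots> = q / (k + m) * ((2 * (k + 1) + m) * Z + (k + 2) * ((2 * k + m) * L - (k + 1) * q * S))"
    using m by (simp add: divide_simps) (simp add: algebra_simps)
  also have "\<dots> = q / (k + m) * ((k + 3) * (k + m) * Z)"
    unfolding rec[symmetric] by (simp add: algebra_simps)
  also have "\<dots> = (k + 3) * q * Z"
    using m by (simp add: field_simps)
  finally show ?case by (simp add: q_def Z_def algebra_simps)
qed

text \<open>In the recurrence only commutator terms survive the induction hypothesis. They are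
  \<open>2(k+1)|u|^2\<close> times \<open>zonal k u\<close> from the linear form and
  \<open>4k + 2m\<close> times it from \<open>|x|^2\<close>, where \<open>m = card I\<close>; with
  the recurrence coefficients they cancel.\<close>

lemma laplace_zonal:
  assumes "card I \<ge> 2"
  shows "laplace (zonal k u) \<alpha> = 0"
proof (induction k arbitrary: \<alpha> rule: induct_nat_012)
  case 0
  have "deriv_var i vacuum = (\<lambda>\<alpha>. 0)" for i :: 'i by (simp add: fun_eq_iff)
  then show ?case by (simp add: laplace_def deriv_var_linear[abs_def])
next
  case 1
  have "deriv_var i vacuum = (\<lambda>\<alpha>. 0)" for i :: 'i by (simp add: fun_eq_iff)
  then have "laplace vacuum = (\<lambda>\<alpha>. 0)" "dir_deriv u vacuum = (\<lambda>\<alpha>. 0)"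
    by (simp_all add: laplace_def dir_deriv_def deriv_var_linear[abs_def])
  then show ?case by (simp add: laplace_mult_lin op_linear)
next
  case (ge2 k)
  have 0: "laplace (zonal k u) = (\<lambda>\<alpha>. 0)" "laplace (zonal (Suc k) u) = (\<lambda>\<alpha>. 0)"
    using ge2 by (simp_all add: fun_eq_iff)
  \<comment> \<open>By homogeneity the total exponent equals \<open>k\<close> wherever the
    coefficient is nonzero.\<close>
  have h: "real (sum \<alpha> I) * zonal k u \<alpha> = k * zonal k u \<alpha>"
    using homogeneous_zonal[of k u] by (auto simp: homogeneous_def)
  have h': "(4 * real (sum \<alpha> I) + 2 * real (card I)) * zonal k u \<alpha>
      = (4 * k + 2 * real (card I)) * zonal k u \<alpha>"
    using h by (simp only: distrib_right mult.assoc)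
  have "laplace (zonal (Suc (Suc k)) u) \<alpha> = 
     (2 * real k + real (card I)) / (real k + real (card I) - 1) * (2 * (real (Suc k) * dot u u * zonal k u \<alpha>))
     - (real k + 1) / (real k + real (card I) - 1) * dot u u * ((4 * k + 2 * card I) * zonal k u \<alpha>)"
    by (simp only: zonal.simps(3) op_linear laplace_mult_lin laplace_mult_sq 0 dir_deriv_zonal[OF assms] h') simp
  also have "\<dots> = 0" by (simp add: field_simps)
  finally show ?case .
qed


section \<open>The Fischer inner product and its values on zonal polynomials\<close>

text \<open>Vanishing outside \<open>I\<close> makes the set finite and each monomial in the
  variables of \<open>I\<close> occur once.\<close>

definition multi_indices :: "nat \<Rightarrow> ('i \<Rightarrow> nat) set" where
  "multi_indices k = {\<alpha>. (\<forall>i. i \<notin> I \<longrightarrow> \<alpha> i = 0) \<and> sum \<alpha> I = k}"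

text \<open>
  With the weights \<open>\<alpha>!\<close> (the Fischer inner product), multiplication by a variable is adjoint to
  differentiation.
\<close>

definition multi_fact :: "('i \<Rightarrow> nat) \<Rightarrow> real" where
  "multi_fact \<alpha> = (\<Prod>i\<in>I. fact (\<alpha> i))"

definition fischer :: "nat \<Rightarrow> (('i \<Rightarrow> nat) \<Rightarrow> real) \<Rightarrow> (('i \<Rightarrow> nat) \<Rightarrow> real) \<Rightarrow> real" where
  "fischer k p q = (\<Sum>\<alpha>\<in>multi_indices k. multi_fact \<alpha> * p \<alpha> * q \<alpha>)"

lemma finite_multi_indices [simp]: "finite (multi_indices k)"
proof (rule finite_subset)
  show "multi_indices k \<subseteq> {\<alpha>. \<forall>i. (i \<in> I \<longrightarrow> \<alpha> i \<in> {..k}) \<and> (i \<notin> I \<longrightarrow> \<alpha> i = 0)}"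
    by (auto simp: multi_indices_def intro: member_le_sum)
  show "finite {\<alpha>. \<forall>i. (i \<in> I \<longrightarrow> \<alpha> i \<in> {..k}) \<and> (i \<notin> I \<longrightarrow> \<alpha> i = 0)}"
    by (rule finite_set_of_finite_funs) auto
qed

lemma multi_fact_nonneg: "multi_fact \<alpha> \<ge> 0"
  by (simp add: multi_fact_def prod_nonneg)

lemma sum_upd_Suc:
  assumes "i \<in> I"
  shows "sum (\<alpha>(i := \<alpha> i + 1)) I = Suc (sum \<alpha> I)"
proof -
  have "sum (\<alpha>(i := \<alpha> i + 1)) I = \<alpha> i + 1 + sum \<alpha> (I - {i})"
    using assms by (subst sum.remove[of I i]) auto
  moreover have "sum \<alpha> I = \<alpha> i + sum \<alpha> (I - {i})"
    using assms by (subst sum.remove[of I i]) auto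
  ultimately show ?thesis by simp
qed

lemma multi_fact_upd_Suc:
  assumes "i \<in> I"
  shows "multi_fact (\<alpha>(i := \<alpha> i + 1)) = real (\<alpha> i + 1) * multi_fact \<alpha>"
proof -
  have "multi_fact (\<alpha>(i := \<alpha> i + 1)) = fact (\<alpha> i + 1) * (\<Prod>j\<in>I-{i}. fact (\<alpha> j))"
    using assms unfolding multi_fact_def by (subst prod.remove[of I i]) auto
  moreover have "multi_fact \<alpha> = fact (\<alpha> i) * (\<Prod>j\<in>I-{i}. fact (\<alpha> j))"
    using assms unfolding multi_fact_def by (subst prod.remove[of I i]) auto
  ultimately show ?thesis by (simp add: algebra_simps)
qed

text \<open>Shift the exponent of \<open>i\<close> down by one: the ratio of the factorial weights
  is exactly the factor \<open>\<alpha> i + 1\<close> produced by differentiation.\<close>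

lemma fischer_mult_var:
  assumes i: "i \<in> I"
  shows "fischer (Suc k) p (mult_var i q) = fischer k (deriv_var i p) q"
proof -
  have "fischer (Suc k) p (mult_var i q)
      = (\<Sum>\<alpha>\<in>{\<alpha>\<in>multi_indices (Suc k). \<alpha> i > 0}. multi_fact \<alpha> * p \<alpha> * mult_var i q \<alpha>)"
    unfolding fischer_def
    by (rule sum.mono_neutral_right) (auto simp: mult_var_def)
  also have "\<dots> = (\<Sum>\<alpha>\<in>multi_indices k. multi_fact \<alpha> * deriv_var i p \<alpha> * q \<alpha>)"
  proof (rule sum.reindex_bij_witness[where i = "\<lambda>\<alpha>. \<alpha>(i := \<alpha> i + 1)" and j = "\<lambda>\<alpha>. \<alpha>(i := \<alpha> i - 1)"])
    fix \<alpha> assume \<alpha>: "\<alpha> \<in> {\<alpha> \<in> multi_indices (Suc k). 0 < \<alpha> i}"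
    define \<beta> where "\<beta> = \<alpha>(i := \<alpha> i - 1)"
    have \<alpha>\<beta>: "\<alpha> = \<beta>(i := \<beta> i + 1)" using \<alpha> by (auto simp: \<beta>_def)
    show "(\<alpha>(i := \<alpha> i - 1))(i := (\<alpha>(i := \<alpha> i - 1)) i + 1) = \<alpha>"
      using \<alpha> by auto
    have "Suc (sum \<beta> I) = Suc k"
      using \<alpha> sum_upd_Suc[OF i, of \<beta>] unfolding \<alpha>\<beta>[symmetric] by (simp add: multi_indices_def)
    moreover have "\<forall>j. j \<notin> I \<longrightarrow> \<beta> j = 0"
      using \<alpha> i by (auto simp: multi_indices_def \<beta>_def)
    ultimately show "\<alpha>(i := \<alpha> i - 1) \<in> multi_indices k"
      unfolding \<beta>_def[symmetric] by (simp add: multi_indices_def)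
    show "multi_fact (\<alpha>(i := \<alpha> i - 1)) * deriv_var i p (\<alpha>(i := \<alpha> i - 1)) * q (\<alpha>(i := \<alpha> i - 1))
        = multi_fact \<alpha> * p \<alpha> * mult_var i q \<alpha>"
      unfolding \<beta>_def[symmetric]
      by (simp add: \<alpha>\<beta> multi_fact_upd_Suc[OF i, simplified] deriv_var_def mult_var_def fun_upd_idem)
  next
    fix \<alpha> assume "\<alpha> \<in> multi_indices k"
    then show "\<alpha>(i := \<alpha> i + 1) \<in> {\<alpha> \<in> multi_indices (Suc k). 0 < \<alpha> i}"
      using i sum_upd_Suc[OF i, of \<alpha>] by (auto simp: multi_indices_def simp del: sum.cong)
  qed auto
  finally show ?thesis by (simp add: fischer_def)
qed

lemma fischer_linear:
  "fischer k p (\<lambda>\<alpha>. a * q \<alpha>) = a * fischer k p q"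
  "fischer k p (\<lambda>\<alpha>. q \<alpha> - r \<alpha>) = fischer k p q - fischer k p r"
  "fischer k p (\<lambda>\<alpha>. \<Sum>j\<in>A. f j \<alpha>) = (\<Sum>j\<in>A. fischer k p (f j))"
  "fischer k (\<lambda>\<alpha>. a * q \<alpha>) p = a * fischer k q p"
  "fischer k (\<lambda>\<alpha>. \<Sum>j\<in>A. f j \<alpha>) p = (\<Sum>j\<in>A. fischer k (f j) p)"
proof -
  show "fischer k p (\<lambda>\<alpha>. \<Sum>j\<in>A. f j \<alpha>) = (\<Sum>j\<in>A. fischer k p (f j))"
    unfolding fischer_def sum_distrib_left by (rule sum.swap)
  show "fischer k (\<lambda>\<alpha>. \<Sum>j\<in>A. f j \<alpha>) p = (\<Sum>j\<in>A. fischer k (f j) p)"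
    unfolding fischer_def sum_distrib_left sum_distrib_right by (rule sum.swap)
qed (simp_all add: fischer_def sum_distrib_left algebra_simps sum_subtractf)

lemma fischer_mult_lin: "fischer (Suc k) p (mult_lin u q) = fischer k (dir_deriv u p) q"
  by (simp add: mult_lin_def dir_deriv_def fischer_linear fischer_mult_var)

lemma fischer_mult_sq: "fischer (Suc (Suc k)) p (mult_sq q) = fischer k (laplace p) q"
  by (simp add: mult_sq_def laplace_def fischer_linear fischer_mult_var)

lemma fischer_vacuum: "fischer 0 p vacuum = p (\<lambda>_. 0)"
proof -
  have "multi_indices 0 = {\<lambda>_. 0}"
    by (auto simp: multi_indices_def fun_eq_iff)
  then show ?thesis by (simp add: fischer_def multi_fact_def vacuum_def)
qed

text \<open>A harmonic polynomial is orthogonal to multiples of \<open>\<bar>x\<bar>\<^sup>2\<close>, so only the leading term of the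
  recurrence contributes.\<close>

lemma fischer_zonal:
  assumes "card I \<ge> 2"
  shows "\<exists>c>0. \<forall>h v. (\<forall>\<alpha>. laplace h \<alpha> = 0) \<longrightarrow>
    fischer k h (zonal k v) = c * (dir_deriv v ^^ k) h (\<lambda>_. 0)"
proof (induction k rule: induct_nat_012)
  case 0
  then show ?case by (auto simp: fischer_vacuum intro!: exI[of _ 1])
next
  case 1
  then show ?case by (auto simp: fischer_vacuum fischer_mult_lin intro!: exI[of _ 1])
next
  case (ge2 k)
  then obtain c where c: "c > 0" "\<And>h v. (\<forall>\<alpha>. laplace h \<alpha> = 0) \<Longrightarrow>
      fischer (Suc k) h (zonal (Suc k) v) = c * (dir_deriv v ^^ Suc k) h (\<lambda>_. 0)"
    by blast
  show ?case
  \<comment> \<open>The constant grows by the leading coefficient of the recurrence, which is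
    positive and independent of \<open>h\<close> and \<open>v\<close>.\<close>
  proof (intro exI[of _ "(2 * real k + real (card I)) / (real k + real (card I) - 1) * c"] conjI allI impI)
    show "(2 * real k + real (card I)) / (real k + real (card I) - 1) * c > 0"
      using assms c by auto
    fix h v assume h: "\<forall>\<alpha>. laplace h \<alpha> = 0"
    then have h': "laplace h = (\<lambda>\<alpha>. 0)" by auto
    have "\<forall>\<alpha>. laplace (dir_deriv v h) \<alpha> = 0"
      by (simp add: laplace_dir_deriv h' op_linear)
    note c(2)[OF this, of v]
    moreover have "fischer k (\<lambda>\<alpha>. 0) q = 0" for q
      by (simp add: fischer_def)
    ultimately show "fischer (Suc (Suc k)) h (zonal (Suc (Suc k)) v) =
        (2 * real k + real (card I)) / (real k + real (card I) - 1) * c *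
        (dir_deriv v ^^ Suc (Suc k)) h (\<lambda>_. 0)"
      by (simp only: zonal.simps(3) fischer_linear fischer_mult_lin fischer_mult_sq h')
        (simp add: funpow_swap1)
  qed
qed

section \<open>Iterated derivatives of zonal polynomials and positive definiteness\<close>

lemma dir_deriv_pow_linear:
  "(dir_deriv v ^^ n) (\<lambda>\<alpha>. a * p \<alpha> - b * q \<alpha>) \<alpha>
    = a * (dir_deriv v ^^ n) p \<alpha> - b * (dir_deriv v ^^ n) q \<alpha>"
proof (induction n arbitrary: \<alpha>)
  case (Suc n)
  then have "(dir_deriv v ^^ n) (\<lambda>\<alpha>. a * p \<alpha> - b * q \<alpha>)
      = (\<lambda>\<alpha>. a * (dir_deriv v ^^ n) p \<alpha> - b * (dir_deriv v ^^ n) q \<alpha>)" by auto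
  then show ?case by (simp add: op_linear)
qed simp

text \<open>Leibniz rule; the expansion stops after one derivative of the linear factor.\<close>

lemma dir_deriv_pow_mult_lin:
  "(dir_deriv v ^^ Suc n) (mult_lin u p) \<alpha> = mult_lin u ((dir_deriv v ^^ Suc n) p) \<alpha>
    + real (Suc n) * dot u v * (dir_deriv v ^^ n) p \<alpha>"
proof (induction n arbitrary: \<alpha>)
  case 0
  then show ?case by (simp add: dir_deriv_mult_lin)
next
  case (Suc n)
  then have "(dir_deriv v ^^ Suc n) (mult_lin u p) = (\<lambda>\<alpha>. mult_lin u ((dir_deriv v ^^ Suc n) p) \<alpha>
    + real (Suc n) * dot u v * (dir_deriv v ^^ n) p \<alpha>)" by (simp add: fun_eq_iff)
  then have "(dir_deriv v ^^ Suc (Suc n)) (mult_lin u p) \<alpha>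
     = dir_deriv v (\<lambda>\<alpha>. mult_lin u ((dir_deriv v ^^ Suc n) p) \<alpha>
    + real (Suc n) * dot u v * (dir_deriv v ^^ n) p \<alpha>) \<alpha>" by simp
  then show ?case by (simp add: op_linear dir_deriv_mult_lin) (simp add: algebra_simps)
qed

text \<open>Leibniz rule for the quadratic factor \<open>|x|^2\<close>, whose derivatives along
  \<open>v\<close> are \<open>2 (v \<bullet> x)\<close>, then \<open>2 |v|^2\<close>, then
  0.\<close>

lemma dir_deriv_pow_mult_sq:
  "(dir_deriv v ^^ Suc (Suc n)) (mult_sq p) \<alpha> = mult_sq ((dir_deriv v ^^ Suc (Suc n)) p) \<alpha>
    + 2 * real (n + 2) * mult_lin v ((dir_deriv v ^^ Suc n) p) \<alpha>
    + real (n + 2) * real (n + 1) * dot v v * (dir_deriv v ^^ n) p \<alpha>"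
proof (induction n arbitrary: \<alpha>)
  case 0
  have "dir_deriv v (mult_sq p) = (\<lambda>\<alpha>. mult_sq (dir_deriv v p) \<alpha> + 2 * mult_lin v p \<alpha>)"
    by (simp add: fun_eq_iff dir_deriv_mult_sq)
  then show ?case by (simp add: dir_deriv_mult_lin dir_deriv_mult_sq op_linear algebra_simps)
next
  case (Suc n)
  then have "(dir_deriv v ^^ Suc (Suc n)) (mult_sq p) = (\<lambda>\<alpha>. mult_sq ((dir_deriv v ^^ Suc (Suc n)) p) \<alpha>
    + 2 * real (n + 2) * mult_lin v ((dir_deriv v ^^ Suc n) p) \<alpha>
    + real (n + 2) * real (n + 1) * dot v v * (dir_deriv v ^^ n) p \<alpha>)" by (simp add: fun_eq_iff)
  then have "(dir_deriv v ^^ Suc (Suc (Suc n))) (mult_sq p) \<alpha>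
     = dir_deriv v (\<lambda>\<alpha>. mult_sq ((dir_deriv v ^^ Suc (Suc n)) p) \<alpha>
    + 2 * real (n + 2) * mult_lin v ((dir_deriv v ^^ Suc n) p) \<alpha>
    + real (n + 2) * real (n + 1) * dot v v * (dir_deriv v ^^ n) p \<alpha>) \<alpha>" by simp
  then show ?case by (simp add: op_linear dir_deriv_mult_lin dir_deriv_mult_sq) (simp add: algebra_simps)
qed

text \<open>The \<open>k\<close>-th derivative along \<open>v\<close> of a form of degree
  \<open>k\<close> is \<open>k!\<close> times its value at \<open>v\<close>. Here it is read off the
  recurrence: terms that keep a factor \<open>mult_lin\<close> or \<open>mult_sq\<close> have no
  constant coefficient.\<close>

lemma dir_deriv_pow_zonal:
  "(dir_deriv v ^^ k) (zonal k u) (\<lambda>_. 0) = fact k * bi_geg (card I) k (dot u v) (dot u u * dot v v)"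
proof (induction k rule: induct_nat_012)
  case 0
  then show ?case by (simp add: vacuum_def)
next
  case 1
  have at0: "mult_lin w q (\<lambda>_. 0) = 0" for w q by (simp add: mult_lin_def)
  show ?case using at0 by (simp add: dir_deriv_mult_lin vacuum_def)
next
  case (ge2 k)
  have at0: "mult_lin w q (\<lambda>_. 0) = 0" "mult_sq q (\<lambda>_. 0) = 0" for w q
    by (simp_all add: mult_lin_def mult_sq_def)
  have "(dir_deriv v ^^ Suc (Suc k)) (zonal (Suc (Suc k)) u) (\<lambda>_. 0)
     = (2 * real k + real (card I)) / (real k + real (card I) - 1) *
       (real (Suc (Suc k)) * dot u v * (fact (Suc k) * bi_geg (card I) (Suc k) (dot u v) (dot u u * dot v v)))
     - (real k + 1) / (real k + real (card I) - 1) * dot u u *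
       (real (k + 2) * real (k + 1) * dot v v * (fact k * bi_geg (card I) k (dot u v) (dot u u * dot v v)))"
    by (simp only: zonal.simps(3) dir_deriv_pow_linear dir_deriv_pow_mult_lin dir_deriv_pow_mult_sq at0 ge2) simp
  also have "\<dots> = fact (Suc (Suc k)) * bi_geg (card I) (Suc (Suc k)) (dot u v) (dot u u * dot v v)"
  proof -
    have "A * (real (Suc (Suc k)) * s * (fact (Suc k) * b1)) - B * p * (real (k + 2) * real (k + 1) * q * (fact k * b0))
        = fact (Suc (Suc k)) * (A * s * b1 - B * (p * q) * b0)" for A B s p q b0 b1 :: real
      by (simp add: algebra_simps)
    then show ?thesis unfolding bi_geg.simps .
  qed
  finally show ?case .
qed

text \<open>Up to a positive constant the kernel is the Gram matrix \<open>K\<close> of the zonal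
  polynomials. Expanding \<open>K\<close> over multi-indices turns the sum into weighted values of
  the quadratic form of \<open>M\<close> at the vectors
  \<open>i \<mapsto> \<Sum>a\<in>S. x a ^ i * zonal k (w a) \<alpha>\<close>.\<close>

theorem bi_geg_kernel_psd:
  fixes x :: "'s \<Rightarrow> real" and w :: "'s \<Rightarrow> 'i \<Rightarrow> real"
  assumes "card I \<ge> 2" and M: "psd s M"
  shows "(\<Sum>a\<in>S. \<Sum>b\<in>S. \<Sum>i<s. \<Sum>j<s. M i j * (x a ^ i * x b ^ j *
    bi_geg (card I) k (dot (w a) (w b)) (dot (w a) (w a) * dot (w b) (w b)))) \<ge> 0"
proof -
  obtain c where c: "c > 0" "\<And>h v. (\<forall>\<alpha>. laplace h \<alpha> = 0) \<Longrightarrow>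
      fischer k h (zonal k v) = c * (dir_deriv v ^^ k) h (\<lambda>_. 0)"
    using fischer_zonal[OF assms(1), of k] by blast
  define K where "K a b = fischer k (zonal k (w a)) (zonal k (w b))" for a b
  have K: "bi_geg (card I) k (dot (w a) (w b)) (dot (w a) (w a) * dot (w b) (w b)) = K a b / (c * fact k)" for a b
    unfolding K_def using c laplace_zonal[OF assms(1)] by (simp add: dir_deriv_pow_zonal)
  have "(\<Sum>a\<in>S. \<Sum>b\<in>S. \<Sum>i<s. \<Sum>j<s. M i j * (x a ^ i * x b ^ j * K a b))
      = (\<Sum>a\<in>S. \<Sum>b\<in>S. \<Sum>i<s. \<Sum>j<s. \<Sum>\<alpha>\<in>multi_indices k.
          multi_fact \<alpha> * (M i j * (x a ^ i * zonal k (w a) \<alpha>) * (x b ^ j * zonal k (w b) \<alpha>)))"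
    by (simp add: K_def fischer_def sum_distrib_left mult_ac)
  also have "\<dots> = (\<Sum>\<alpha>\<in>multi_indices k. \<Sum>i<s. \<Sum>j<s. \<Sum>a\<in>S. \<Sum>b\<in>S.
          multi_fact \<alpha> * (M i j * (x a ^ i * zonal k (w a) \<alpha>) * (x b ^ j * zonal k (w b) \<alpha>)))"
    by (simp only: sum.swap[of _ "multi_indices k" S] sum.swap[of _ "multi_indices k" "{..<s}"] sum.swap[of _ "{..<s}" S])
  also have "\<dots> = (\<Sum>\<alpha>\<in>multi_indices k. multi_fact \<alpha> * (\<Sum>i<s. \<Sum>j<s.
      (\<Sum>a\<in>S. x a ^ i * zonal k (w a) \<alpha>) * M i j * (\<Sum>b\<in>S. x b ^ j * zonal k (w b) \<alpha>)))"
    by (simp add: sum_distrib_left sum_distrib_right mult_ac)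
  also have "\<dots> \<ge> 0"
  proof (intro sum_nonneg[where A = "multi_indices k"] mult_nonneg_nonneg[OF multi_fact_nonneg])
    fix \<alpha>
    have "(\<Sum>i<s. \<Sum>j<s. v i * M i j * v j) \<ge> 0" for v :: "nat \<Rightarrow> real"
      using M by (simp add: psd_def)
    then show "(\<Sum>i<s. \<Sum>j<s. (\<Sum>a\<in>S. x a ^ i * zonal k (w a) \<alpha>) * M i j *
        (\<Sum>b\<in>S. x b ^ j * zonal k (w b) \<alpha>)) \<ge> 0" .
  qed
  finally have "0 \<le> (\<Sum>a\<in>S. \<Sum>b\<in>S. \<Sum>i<s. \<Sum>j<s. M i j * (x a ^ i * x b ^ j * K a b)) / (c * fact k)"
    using c by simp
  then show ?thesis
    by (simp add: K sum_divide_distrib)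
qed

end

section \<open>Gegenbauer polynomials\<close>

fun geg_poly :: "nat \<Rightarrow> nat \<Rightarrow> real poly" where
  "geg_poly m 0 = 1"
| "geg_poly m (Suc 0) = [:0, 1:]"
| "geg_poly m (Suc (Suc k)) =
     smult ((2 * real k + real m) / (real k + real m - 1)) ([:0, 1:] * geg_poly m (Suc k))
     - smult ((real k + 1) / (real k + real m - 1)) (geg_poly m k)"

lemma poly_geg_poly_1:
  assumes "m \<ge> 2"
  shows "poly (geg_poly m k) 1 = 1"
proof (induction k rule: induct_nat_012)
  case (ge2 k)
  then show ?case using assms by (simp add: divide_simps)
qed auto

lemma degree_geg_poly:
  assumes "m \<ge> 2"
  shows "degree (geg_poly m k) = k"
proof -
  \<comment> \<open>The nonzero top coefficient must be carried along, since the recurrence by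
    itself yields only an upper bound on the degree.\<close>
  have "degree (geg_poly m k) \<le> k \<and> coeff (geg_poly m k) k \<noteq> 0"
  proof (induction k rule: induct_nat_012)
    case (ge2 k)
    have 1: "degree ([:0, 1:] * geg_poly m (Suc k)) \<le> Suc (Suc k)"
      using ge2 by (intro order.trans[OF degree_mult_le]) auto
    have "degree (geg_poly m (Suc (Suc k))) \<le> Suc (Suc k)"
      unfolding geg_poly.simps using ge2 1
      by (intro degree_diff_le order.trans[OF degree_smult_le]) (auto simp del: geg_poly.simps)
    moreover have "coeff (geg_poly m k) (Suc (Suc k)) = 0"
      using ge2 by (intro coeff_eq_0) auto
    ultimately show ?case using ge2 assms by auto
  qed auto
  then show ?thesis by (meson le_antisym le_degree)
qed

lemma bi_geg_eq_geg_poly: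
  assumes "r \<noteq> 0"
  shows "bi_geg m k s (r\<^sup>2) = r ^ k * poly (geg_poly m k) (s / r)"
proof (induction k rule: induct_nat_012)
  case (ge2 k)
  have "bi_geg m (Suc (Suc k)) s (r\<^sup>2) = A * s * (r * r ^ k * b1) - B * r\<^sup>2 * (r ^ k * b0)"
    if "A = (2 * real k + real m) / (real k + real m - 1)" "B = (real k + 1) / (real k + real m - 1)"
      "b1 = poly (geg_poly m (Suc k)) (s / r)" "b0 = poly (geg_poly m k) (s / r)" for A B b0 b1
    using that ge2 by (simp del: geg_poly.simps)
  then show ?case
    using assms by (simp add: power2_eq_square algebra_simps)
qed (use assms in auto)

lemma mult_denominator:
  fixes d :: real
  assumes "x = a / d * u - b / d * v" "d \<noteq> 0"
  shows "d * x = a * u - b * v"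
  using assms by (simp add: right_diff_distrib)

text \<open>A first-order ladder relation; differentiating it once leads to the second-order
  equation. The induction combines the recurrence with its derivative.\<close>

lemma geg_poly_derivative:
  assumes "m \<ge> 2"
  shows "(1 - t\<^sup>2) * poly (pderiv (geg_poly m (Suc k))) t
    = (real k + 1) * (poly (geg_poly m k) t - t * poly (geg_poly m (Suc k)) t)"
proof (induction k rule: induct_nat_012)
  case 0
  then show ?case by (simp add: pderiv_pCons power2_eq_square)
next
  case 1
  have "real m - 1 \<noteq> 0" using assms by simp
  then show ?case
    by (simp add: pderiv_pCons pderiv_diff pderiv_smult pderiv_mult divide_simps)
      (simp add: algebra_simps power2_eq_square)
next
  case (ge2 k)
  define c where "c = real m"
  define n where "n = real k"
  have pos: "c \<ge> 2" "n \<ge> 0" using assms by (auto simp: c_def n_def)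
  define P0 P1 P2 P3 where P: "P0 = poly (geg_poly m k) t" "P1 = poly (geg_poly m (Suc k)) t"
    "P2 = poly (geg_poly m (Suc (Suc k))) t" "P3 = poly (geg_poly m (Suc (Suc (Suc k)))) t"
  define D1 D2 D3 where D: "D1 = poly (pderiv (geg_poly m (Suc k))) t"
    "D2 = poly (pderiv (geg_poly m (Suc (Suc k)))) t" "D3 = poly (pderiv (geg_poly m (Suc (Suc (Suc k))))) t"
  have r2: "(n + c - 1) * P2 = (2 * n + c) * t * P1 - (n + 1) * P0"
  proof -
    have "P2 = (2 * n + c) / (n + c - 1) * (t * P1) - (n + 1) / (n + c - 1) * P0"
      by (simp add: P n_def c_def)
    from mult_denominator[OF this] show ?thesis using pos by (simp add: mult.assoc)
  qed
  have "P3 = (2 * (n + 1) + c) / (n + c) * (t * P2) - (n + 2) / (n + c) * P1"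
    unfolding P n_def c_def by (subst geg_poly.simps(3)) (simp add: algebra_simps del: geg_poly.simps)
  from mult_denominator[OF this] have r3: "(n + c) * P3 = (2 * (n + 1) + c) * t * P2 - (n + 2) * P1"
    using pos by (simp add: mult.assoc)
  have "D3 = (2 * (n + 1) + c) / (n + c) * (P2 + t * D2) - (n + 2) / (n + c) * D1"
    unfolding P D n_def c_def 
    by (subst geg_poly.simps(3)) 
      (simp add: pderiv_diff pderiv_smult pderiv_mult pderiv_pCons algebra_simps add_divide_distrib del: geg_poly.simps)
  from mult_denominator[OF this] have r3': "(n + c) * D3 = (2 * (n + 1) + c) * (P2 + t * D2) - (n + 2) * D1"
    using pos by simp
  have d1: "(1 - t\<^sup>2) * D1 = (n + 1) * (P0 - t * P1)" and d2: "(1 - t\<^sup>2) * D2 = (n + 2) * (P1 - t * P2)"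
    using ge2 by (simp_all add: P D n_def algebra_simps del: geg_poly.simps)
  \<comment> \<open>Trading \<open>P0\<close> for \<open>P2\<close> by the recurrence leaves only
    \<open>P1\<close> and \<open>P2\<close> in the final computation.\<close>
  have d1': "(1 - t\<^sup>2) * D1 = (n + c - 1) * (t * P1 - P2)"
    using d1 r2 by (simp add: algebra_simps)
  have "(n + c) * ((1 - t\<^sup>2) * D3) = (1 - t\<^sup>2) * ((n + c) * D3)" by (simp add: mult_ac)
  also have "\<dots> = (2 * (n + 1) + c) * ((1 - t\<^sup>2) * P2 + t * ((1 - t\<^sup>2) * D2)) - (n + 2) * ((1 - t\<^sup>2) * D1)"
    unfolding r3' by (simp add: algebra_simps)
  also have "\<dots> = (n + 3) * ((n + c) * P2 - t * ((n + c) * P3))"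
    unfolding d1' d2 r3 by (simp add: algebra_simps power2_eq_square)
  also have "\<dots> = (n + c) * ((n + 3) * (P2 - t * P3))" by (simp add: algebra_simps)
  finally have "(1 - t\<^sup>2) * D3 = (n + 3) * (P2 - t * P3)" using pos by simp
  then show ?case by (simp add: P D n_def algebra_simps del: geg_poly.simps)
qed

text \<open>Differentiate the ladder relation for \<open>P\<close> and eliminate the derivative of
  \<open>Q\<close> by the companion relation \<open>B\<close>. This is done after multiplying by
  \<open>1 - t^2\<close>, which is nonzero for \<open>\<bar>t\<bar> < 1\<close> and is cancelled at
  the end.\<close>

lemma geg_poly_ode:
  assumes "m \<ge> 2" "\<bar>t\<bar> < 1"
  shows "(1 - t\<^sup>2) * poly (pderiv (pderiv (geg_poly m k))) t
    = (real m - 1) * t * poly (pderiv (geg_poly m k)) t - real k * (real k + real m - 2) * poly (geg_poly m k) t"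
proof (cases k)
  case 0
  then show ?thesis by simp
next
  case (Suc n)
  define P Q where PQ: "P = geg_poly m (Suc n)" "Q = geg_poly m n"
  have A: "(1 - t\<^sup>2) * poly (pderiv P) t = (real n + 1) * (poly Q t - t * poly P t)" for t
    unfolding PQ by (rule geg_poly_derivative[OF assms(1)])
  \<comment> \<open>Since \<open>A\<close> holds at every point, it is an identity of polynomials
    and can be differentiated formally.\<close>
  have "[:1, 0, -1:] * pderiv P = smult (real n + 1) (Q - [:0, 1:] * P)"
    by (rule poly_ext) (use A in \<open>simp add: power2_eq_square algebra_simps\<close>)
  then have "pderiv ([:1, 0, -1:] * pderiv P) = pderiv (smult (real n + 1) (Q - [:0, 1:] * P))"
    by simp
  then have "poly (pderiv ([:1, 0, -1:] * pderiv P)) t = poly (pderiv (smult (real n + 1) (Q - [:0, 1:] * P))) t"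
    by simp
  then have A': "(1 - t\<^sup>2) * poly (pderiv (pderiv P)) t - 2 * t * poly (pderiv P) t
    = (real n + 1) * (poly (pderiv Q) t - poly P t - t * poly (pderiv P) t)"
    unfolding pderiv_mult pderiv_smult pderiv_diff
    by (simp add: pderiv_pCons power2_eq_square algebra_simps)
  \<comment> \<open>The ladder relation in the other direction, from \<open>A\<close> for
    \<open>Q\<close> and the recurrence. For \<open>n = 0\<close> both sides vanish because
    \<open>Q = 1\<close> and \<open>P\<close> is the variable.\<close>
  have B: "(1 - t\<^sup>2) * poly (pderiv Q) t = (real n + real m - 2) * (t * poly Q t - poly P t)"
  proof (cases n)
    case 0
    then show ?thesis by (simp add: PQ)
  next
    case (Suc l)
    have "P = smult ((2 * real l + real m) / (real l + real m - 1)) ([:0, 1:] * Q)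
      - smult ((real l + 1) / (real l + real m - 1)) (geg_poly m l)"
      by (simp add: PQ Suc)
    then have "poly P t = (2 * real l + real m) / (real l + real m - 1) * (t * poly Q t)
      - (real l + 1) / (real l + real m - 1) * poly (geg_poly m l) t" by simp
    from mult_denominator[OF this]
    have "(real l + real m - 1) * poly P t = (2 * real l + real m) * t * poly Q t - (real l + 1) * poly (geg_poly m l) t"
      using assms by (simp add: mult.assoc)
    moreover have "(1 - t\<^sup>2) * poly (pderiv Q) t = (real l + 1) * (poly (geg_poly m l) t - t * poly Q t)"
      unfolding PQ Suc by (rule geg_poly_derivative[OF assms(1)])
    ultimately show ?thesis by (simp add: Suc algebra_simps)
  qed
  have "1 - t\<^sup>2 \<noteq> 0" using assms(2) by (simp add: abs_square_eq_1)
  moreover have "(1 - t\<^sup>2) * ((1 - t\<^sup>2) * poly (pderiv (pderiv P)) t)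
    = (1 - t\<^sup>2) * ((real m - 1) * t * poly (pderiv P) t - (real n + 1) * (real n + real m - 1) * poly P t)"
  proof -
    have "(1 - t\<^sup>2) * ((1 - t\<^sup>2) * poly (pderiv (pderiv P)) t)
      = (1 - t\<^sup>2) * (2 * t * poly (pderiv P) t - (real n + 1) * (poly P t + t * poly (pderiv P) t))
        + (real n + 1) * ((1 - t\<^sup>2) * poly (pderiv Q) t)"
    proof -
      have "(1 - t\<^sup>2) * poly (pderiv (pderiv P)) t
          = 2 * t * poly (pderiv P) t + (real n + 1) * (poly (pderiv Q) t - poly P t - t * poly (pderiv P) t)"
        using A' by linarith
      then show ?thesis by (simp only:) (simp add: algebra_simps)
    qed
    also have "\<dots> = (1 - t\<^sup>2) * (2 * t * poly (pderiv P) t - (real n + 1) * (poly P t + t * poly (pderiv P) t))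
        + (real n + real m - 2) * (t * ((1 - t\<^sup>2) * poly (pderiv P) t) - (real n + 1) * (1 - t\<^sup>2) * poly P t)"
      unfolding A B by (simp add: algebra_simps power2_eq_square)
    also have "\<dots> = (1 - t\<^sup>2) * ((real m - 1) * t * poly (pderiv P) t - (real n + 1) * (real n + real m - 1) * poly P t)"
      by (simp add: algebra_simps)
    finally show ?thesis .
  qed
  ultimately have "(1 - t\<^sup>2) * poly (pderiv (pderiv P)) t
    = (real m - 1) * t * poly (pderiv P) t - (real n + 1) * (real n + real m - 1) * poly P t"
    by (metis mult_left_cancel)
  then show ?thesis
    by (simp only: Suc PQ) (simp add: algebra_simps)
qed

text \<open>
  Sturm--Liouville argument: by the differential equation, \<open>(\<lambda>\<^sub>j - \<lambda>\<^sub>i) P\<^sub>i P\<^sub>j\<close> times the weight is the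
  derivative of a weighted Wronskian that vanishes at both endpoints.
\<close>

lemma geg_poly_orthogonal:
  assumes "m \<ge> 2" "i \<noteq> j"
  shows "integral {-1..1} (\<lambda>t. poly (geg_poly m i) t * poly (geg_poly m j) t * (1 - t\<^sup>2) powr ((real m - 3) / 2)) = 0"
proof -
  define P Q where PQ: "P = geg_poly m i" "Q = geg_poly m j"
  define lam where "lam k = real k * (real k + real m - 2)" for k
  define W where "W t = (1 - t\<^sup>2) powr ((real m - 1) / 2) * poly (pderiv P * Q - P * pderiv Q) t" for t
  define w where "w t = (1 - t\<^sup>2) powr ((real m - 3) / 2)" for t :: real
  \<comment> \<open>Distinct degrees have distinct eigenvalues: the second factor is positive
    because \<open>i + j > 0\<close> and \<open>m \<ge> 2\<close>.\<close>
  have "(lam j - lam i) = (real j - real i) * (real i + real j + real m - 2)"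
    by (simp add: lam_def algebra_simps)
  moreover have "real i + real j + real m - 2 > 0" using assms by auto
  ultimately have lam: "lam j - lam i \<noteq> 0" using assms by auto
  have "((\<lambda>t. (lam j - lam i) * (poly P t * poly Q t * w t)) has_integral W 1 - W (-1)) {-1..1}"
  proof (rule fundamental_theorem_of_calculus_interior)
    \<comment> \<open>The exponent \<open>(m-1)/2\<close> is positive, so \<open>W\<close> is
      continuous up to the endpoints even for \<open>m = 2\<close>, where the weight itself is
      unbounded.\<close>
    show "continuous_on {-1..1} W"
      unfolding W_def using assms
      by (intro continuous_intros continuous_on_powr') (auto simp: abs_square_le_1 abs_le_iff)
    fix t :: real assume t: "t \<in> {-1<..<1}"
    then have t1: "\<bar>t\<bar> < 1" by auto
    then have pos: "1 - t\<^sup>2 > 0" by (simp add: abs_square_less_1)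
    have pw: "(1 - t\<^sup>2) powr ((real m - 1) / 2) = w t * (1 - t\<^sup>2)"
    proof -
      have "(1 - t\<^sup>2) powr ((real m - 1) / 2) = (1 - t\<^sup>2) powr ((real m - 3) / 2 + 1)"
        by (simp add: field_simps)
      then show ?thesis using pos by (simp only: powr_add w_def) simp
    qed
    have "((\<lambda>t. (1 - t\<^sup>2) powr ((real m - 1) / 2)) has_real_derivative
        ((real m - 1) / 2 * (1 - t\<^sup>2) powr ((real m - 1) / 2 - 1) * (- 2 * t))) (at t)"
      using pos by (auto intro!: derivative_eq_intros DERIV_fun_powr simp: power2_eq_square)
    moreover have "(real m - 1) / 2 - 1 = (real m - 3) / 2" by (simp add: field_simps)
    then have "(real m - 1) / 2 * (1 - t\<^sup>2) powr ((real m - 1) / 2 - 1) * (- 2 * t) = - (real m - 1) * t * w t"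
      by (simp only: w_def) (simp add: field_simps)
    ultimately have d1: "((\<lambda>t. (1 - t\<^sup>2) powr ((real m - 1) / 2)) has_real_derivative
        (- (real m - 1) * t * w t)) (at t)"
      by (rule DERIV_cong)
    have "(W has_real_derivative
        (- (real m - 1) * t * w t) * poly (pderiv P * Q - P * pderiv Q) t
        + poly (pderiv (pderiv P * Q - P * pderiv Q)) t * (1 - t\<^sup>2) powr ((real m - 1) / 2)) (at t)"
      unfolding W_def by (rule DERIV_mult[OF d1 poly_DERIV])
    moreover have "(- (real m - 1) * t * w t) * poly (pderiv P * Q - P * pderiv Q) t
        + poly (pderiv (pderiv P * Q - P * pderiv Q)) t * (1 - t\<^sup>2) powr ((real m - 1) / 2)
        = (lam j - lam i) * (poly P t * poly Q t * w t)"
    proof -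
      have "(- (real m - 1) * t * w t) * poly (pderiv P * Q - P * pderiv Q) t
        + poly (pderiv (pderiv P * Q - P * pderiv Q)) t * (1 - t\<^sup>2) powr ((real m - 1) / 2)
        = w t * (((1 - t\<^sup>2) * poly (pderiv (pderiv P)) t - (real m - 1) * t * poly (pderiv P) t) * poly Q t
         - poly P t * ((1 - t\<^sup>2) * poly (pderiv (pderiv Q)) t - (real m - 1) * t * poly (pderiv Q) t))"
        unfolding pw by (simp add: pderiv_diff pderiv_mult algebra_simps)
      also have "\<dots> = w t * ((- lam i * poly P t) * poly Q t - poly P t * (- lam j * poly Q t))"
        unfolding PQ geg_poly_ode[OF assms(1) t1] by (simp add: lam_def)
      finally show ?thesis by (simp add: algebra_simps)
    qed
    ultimately show "(W has_vector_derivative (lam j - lam i) * (poly P t * poly Q t * w t)) (at t)"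
      by (simp add: has_real_derivative_iff_has_vector_derivative)
  qed auto
  moreover have "W 1 = 0" "W (-1) = 0" by (simp_all add: W_def)
  ultimately have "((\<lambda>t. (lam j - lam i) * (poly P t * poly Q t * w t)) has_integral 0) {-1..1}" by simp
  from has_integral_mult_right[OF this, of "1 / (lam j - lam i)"]
  have "((\<lambda>t. poly P t * poly Q t * w t) has_integral 0) {-1..1}" using lam by simp
  then show ?thesis by (simp add: integral_unique PQ w_def)
qed

section \<open>Integrability against the weight and uniqueness of the orthogonal family\<close>

text \<open>A polynomial is bounded on the interval, and the weight is largest for
  \<open>m = 2\<close>, where it is the derivative of \<open>arcsin\<close>; domination does the
  rest.\<close>

lemma poly_weight_integrable:
  assumes "m \<ge> 2"
  shows "(\<lambda>t. poly q t * (1 - t\<^sup>2) powr ((real m - 3) / 2)) integrable_on {-1..1}"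
proof -
  have "compact (poly q ` {-1..1})"
    by (intro compact_continuous_image continuous_intros) auto
  then have "bounded (poly q ` {-1..1})" by (rule compact_imp_bounded)
  then obtain K where "\<forall>x\<in>poly q ` {-1..1}. norm x \<le> K"
    unfolding bounded_iff by blast
  then have K: "\<And>t. t \<in> {-1..1} \<Longrightarrow> \<bar>poly q t\<bar> \<le> K" by auto
  have "((\<lambda>t. (1 - t\<^sup>2) powr (-1/2)) has_integral (arcsin 1 - arcsin (-1))) {-1..1}"
  proof (rule fundamental_theorem_of_calculus_interior)
    show "continuous_on {-1..1} arcsin" by (rule continuous_on_arcsin')
    fix t :: real assume t: "t \<in> {-1<..<1}"
    then have "1 - t\<^sup>2 > 0" using abs_square_less_1[of t] by auto
    then have "(1 - t\<^sup>2) powr (-1/2) = inverse (sqrt (1 - t\<^sup>2))"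
      by (simp add: powr_minus powr_half_sqrt)
    then show "(arcsin has_vector_derivative (1 - t\<^sup>2) powr (-1/2)) (at t)"
      using t DERIV_arcsin[of t] by (simp add: has_real_derivative_iff_has_vector_derivative)
  qed auto
  then have "(\<lambda>t. K * (1 - t\<^sup>2) powr (-1/2)) integrable_on {-1..1}"
    by (intro integrable_on_mult_right) (auto simp: integrable_on_def)
  moreover have "norm (poly q t * (1 - t\<^sup>2) powr ((real m - 3) / 2)) \<le> K * (1 - t\<^sup>2) powr (-1/2)"
    if t: "t \<in> {-1..1}" for t
  proof -
    have "0 \<le> 1 - t\<^sup>2" "1 - t\<^sup>2 \<le> 1" using t by (auto simp: abs_square_le_1 abs_le_iff)
    then have "(1 - t\<^sup>2) powr ((real m - 3) / 2) \<le> (1 - t\<^sup>2) powr (-1/2)"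
      using assms by (cases "1 - t\<^sup>2 = 0") (auto intro!: powr_mono')
    then show ?thesis using K[OF t] by (auto simp: abs_mult intro!: mult_mono)
  qed
  moreover have "(\<lambda>t. poly q t * (1 - t\<^sup>2) powr ((real m - 3) / 2)) \<in> borel_measurable (lebesgue_on {-1..1})"
  proof -
    have "poly q \<in> borel_measurable borel"
      by (intro borel_measurable_continuous_onI continuous_intros)
    then have "(\<lambda>t. poly q t * (1 - t\<^sup>2) powr ((real m - 3) / 2)) \<in> borel_measurable borel"
      by measurable
    then show ?thesis
      by (intro measurable_restrict_space1 measurable_completion) simp
  qed
  ultimately show ?thesis
    using measurable_bounded_by_integrable_imp_absolutely_integrable absolutely_integrable_on_def
    by (metis (no_types, lifting) atLeastAtMost_borel sets_completionI_sets sets_lborel)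
qed

text \<open>The weight may be singular at the endpoints, so it is replaced by the smaller continuous
  weight \<open>(1 - t^2)^m\<close>, for which a vanishing integral forces the integrand to vanish
  pointwise.\<close>

lemma poly_weight_square_integral_eq_0:
  assumes "m \<ge> 2"
    and "integral {-1..1} (\<lambda>t. poly (q * q) t * (1 - t\<^sup>2) powr ((real m - 3) / 2)) = 0"
  shows "q = 0"
proof -
  have cont: "continuous_on {-1..1} (\<lambda>t. poly (q * q) t * (1 - t\<^sup>2) ^ m)"
    by (intro continuous_intros)
  have nonneg: "poly (q * q) t * (1 - t\<^sup>2) ^ m \<ge> 0" if "t \<in> {-1..1}" for t
    using that by (auto simp: abs_square_le_1 abs_le_iff)
  have "integral {-1..1} (\<lambda>t. poly (q * q) t * (1 - t\<^sup>2) ^ m)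
     \<le> integral {-1..1} (\<lambda>t. poly (q * q) t * (1 - t\<^sup>2) powr ((real m - 3) / 2))"
  proof (rule integral_le)
    show "(\<lambda>t. poly (q * q) t * (1 - t\<^sup>2) ^ m) integrable_on {-1..1}"
      using cont by (rule integrable_continuous_real)
    fix t :: real assume t: "t \<in> {-1..1}"
    have b: "0 \<le> 1 - t\<^sup>2" "1 - t\<^sup>2 \<le> 1" using t by (auto simp: abs_square_le_1 abs_le_iff)
    have "(1 - t\<^sup>2) ^ m \<le> (1 - t\<^sup>2) powr ((real m - 3) / 2)"
    proof (cases "1 - t\<^sup>2 = 0")
      case True
      then show ?thesis using assms(1) by (simp add: power_0_left)
    next
      case False
      then have "(1 - t\<^sup>2) ^ m = (1 - t\<^sup>2) powr m" using b by (simp add: powr_realpow)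
      also have "\<dots> \<le> (1 - t\<^sup>2) powr ((real m - 3) / 2)"
        using b by (intro powr_mono') auto
      finally show ?thesis .
    qed
    then show "poly (q * q) t * (1 - t\<^sup>2) ^ m \<le> poly (q * q) t * (1 - t\<^sup>2) powr ((real m - 3) / 2)"
      by (intro mult_left_mono) auto
  qed (rule poly_weight_integrable[OF assms(1)])
  moreover have "integral {-1..1} (\<lambda>t. poly (q * q) t * (1 - t\<^sup>2) ^ m) \<ge> 0"
    using nonneg by (intro integral_nonneg integrable_continuous_real cont)
  ultimately have "integral {-1..1} (\<lambda>t. poly (q * q) t * (1 - t\<^sup>2) ^ m) = 0"
    using assms(2) by simp
  then have z: "poly (q * q) t * (1 - t\<^sup>2) ^ m = 0" if "t \<in> {-1..1}" for t
    using integral_eq_0_iff[OF cont _ nonneg] that by simp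
  have "poly q t = 0" if t: "t \<in> {-1<..<1}" for t
  proof -
    have "1 - t\<^sup>2 > 0" using t abs_square_less_1[of t] by auto
    then show ?thesis using z[of t] t by auto
  qed
  then have "{-1<..<1} \<subseteq> {t. poly q t = 0}" by auto
  moreover have "infinite {-1<..<(1::real)}" by simp
  ultimately have "infinite {t. poly q t = 0}" using finite_subset by blast
  then show ?thesis using poly_roots_finite by blast
qed

text \<open>Induction on the degree: subtract from \<open>q\<close> the multiple of
  \<open>P (degree q)\<close> that removes its leading term.\<close>

lemma orthogonal_to_lower_degree:
  assumes "m \<ge> 2" "\<And>i. degree (P i) = i" "\<And>i. P i \<noteq> 0"
    and orth: "\<And>i. i < k \<Longrightarrow> integral {-1..1} (\<lambda>t. poly (p * P i) t * (1 - t\<^sup>2) powr ((real m - 3) / 2)) = 0"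
    and "degree q < k"
  shows "integral {-1..1} (\<lambda>t. poly (p * q) t * (1 - t\<^sup>2) powr ((real m - 3) / 2)) = 0"
  using assms(5)
proof (induction "degree q" arbitrary: q rule: less_induct)
  case less
  let ?w = "\<lambda>t. (1 - t\<^sup>2) powr ((real m - 3) / 2)"
  define d where "d = degree q"
  define c where "c = coeff q d / coeff (P d) d"
  define r where "r = q - smult c (P d)"
  have "coeff (P d) d \<noteq> 0" using assms(2,3)[of d] leading_coeff_0_iff[of "P d"] by simp
  then have "coeff r d = 0" by (simp add: r_def c_def)
  moreover have "degree r \<le> d"
    unfolding r_def using assms(2) by (intro degree_diff_le order.trans[OF degree_smult_le]) (auto simp: d_def)
  ultimately have "r = 0 \<or> degree r < d" by (metis leading_coeff_0_iff le_neq_implies_less)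
  then have r: "integral {-1..1} (\<lambda>t. poly (p * r) t * ?w t) = 0"
    using less by (auto simp: d_def)
  have q: "poly (p * q) t * ?w t = poly (p * r) t * ?w t + c * (poly (p * P d) t * ?w t)" for t
    by (simp add: r_def algebra_simps)
  have "integral {-1..1} (\<lambda>t. poly (p * q) t * ?w t)
      = integral {-1..1} (\<lambda>t. poly (p * r) t * ?w t) + integral {-1..1} (\<lambda>t. c * (poly (p * P d) t * ?w t))"
    unfolding q by (intro integral_add integrable_on_mult_right poly_weight_integrable[OF assms(1)])
  also have "\<dots> = 0"
    using r orth[of d] less.prems by (simp add: d_def)
  finally show ?case .
qed

text \<open>Cross-multiplying by the leading coefficients gives a combination \<open>r\<close> of
  lower degree. It is orthogonal to \<open>P k\<close> and \<open>Q k\<close>, hence to itself,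
  hence zero; the values at 1 then equate the leading coefficients.\<close>

lemma gegenbauer_family_unique:
  assumes m: "m \<ge> 2" and P: "gegenbauer_family m P" and Q: "gegenbauer_family m Q"
  shows "P = Q"
proof
  fix k
  show "P k = Q k"
  proof (induction k rule: less_induct)
    case (less k)
    let ?w = "\<lambda>t. (1 - t\<^sup>2) powr ((real m - 3) / 2)"
    have degs: "degree (P i) = i" "degree (Q i) = i" "poly (P i) 1 = 1" "poly (Q i) 1 = 1" for i
      using P Q by (auto simp: gegenbauer_family_def)
    then have nz: "P i \<noteq> 0" "Q i \<noteq> 0" for i by (metis poly_0 zero_neq_one)+
    have orth: "integral {-1..1} (\<lambda>t. poly (P i * P j) t * ?w t) = 0"
      "integral {-1..1} (\<lambda>t. poly (Q i * Q j) t * ?w t) = 0" if "i \<noteq> j" for i j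
      using P Q that by (simp_all add: gegenbauer_family_def)
    define a b where "a = coeff (P k) k" and "b = coeff (Q k) k"
    have "a \<noteq> 0"
      using nz(1)[of k] degs(1)[of k] leading_coeff_0_iff[of "P k"] by (simp add: a_def)
    define r where "r = smult b (P k) - smult a (Q k)"
    have "coeff r k = 0" by (simp add: r_def a_def b_def)
    moreover have "degree r \<le> k"
      unfolding r_def using degs by (intro degree_diff_le order.trans[OF degree_smult_le]) auto
    ultimately have "r = 0 \<or> degree r < k" by (metis leading_coeff_0_iff le_neq_implies_less)
    then have "r = 0"
    proof
      assume deg: "degree r < k"
      have 1: "integral {-1..1} (\<lambda>t. poly (P k * r) t * ?w t) = 0"
        by (rule orthogonal_to_lower_degree[OF m degs(1) nz(1) _ deg]) (intro orth; simp)
      have 2: "integral {-1..1} (\<lambda>t. poly (Q k * r) t * ?w t) = 0"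
        by (rule orthogonal_to_lower_degree[OF m degs(2) nz(2) _ deg]) (intro orth; simp)
      have "integral {-1..1} (\<lambda>t. poly (r * r) t * ?w t)
        = integral {-1..1} (\<lambda>t. b * (poly (P k * r) t * ?w t) - a * (poly (Q k * r) t * ?w t))"
        by (rule arg_cong[where f = "integral _"]) (simp add: r_def fun_eq_iff algebra_simps)
      also have "\<dots> = integral {-1..1} (\<lambda>t. b * (poly (P k * r) t * ?w t)) - integral {-1..1} (\<lambda>t. a * (poly (Q k * r) t * ?w t))"
        by (intro integral_diff integrable_on_mult_right poly_weight_integrable m)
      also have "\<dots> = 0" using 1 2 by simp
      finally show "r = 0" by (rule poly_weight_square_integral_eq_0[OF m])
    qed
    then have eq: "smult b (P k) = smult a (Q k)" by (simp add: r_def)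
    then have "poly (smult b (P k)) 1 = poly (smult a (Q k)) 1" by simp
    then have "a = b" by (simp add: degs)
    then have "smult a (P k - Q k) = 0" using eq by (simp add: smult_diff_right)
    then show ?case using \<open>a \<noteq> 0\<close> by simp
  qed
qed

lemma gegenbauer_eq_geg_poly:
  assumes "m \<ge> 2"
  shows "gegenbauer m = geg_poly m"
proof -
  have "gegenbauer_family m (geg_poly m)"
    unfolding gegenbauer_family_def
    using assms by (simp add: degree_geg_poly poly_geg_poly_1 geg_poly_orthogonal)
  then show ?thesis
    unfolding gegenbauer_def using assms gegenbauer_family_unique by (intro the_equality) blast+
qed

section \<open>The three-point bound\<close>

text \<open>Along the ray through \<open>x\<close> the function is a univariate polynomial with
  infinitely many zeros near 0; evaluate it at 1.\<close>

lemma real_polynomial_function_eq_0: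
  fixes h :: "'a::real_normed_vector \<Rightarrow> real"
  assumes h: "real_polynomial_function h" and e: "e > 0" "\<And>x. norm x < e \<Longrightarrow> h x = 0"
  shows "h x = 0"
proof -
  have "polynomial_function (\<lambda>t::real. t *\<^sub>R x)"
    by (intro polynomial_function_bounded_linear bounded_linear_scaleR_left)
  from real_polynomial_function_compose[OF this h]
  have "real_polynomial_function (\<lambda>t. h (t *\<^sub>R x))" by (simp add: o_def)
  then obtain a n where a: "(\<lambda>t. h (t *\<^sub>R x)) = (\<lambda>t. \<Sum>i\<le>n. a i * t ^ i)"
    using real_polynomial_function_imp_sum by blast
  define q where "q = (\<Sum>i\<le>n. monom (a i) i)"
  have q: "h (t *\<^sub>R x) = poly q t" for t
    using fun_cong[OF a, of t] by (simp add: q_def poly_sum poly_monom)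
  \<comment> \<open>Dividing by \<open>norm x + 1\<close> covers \<open>x = 0\<close> as
    well.\<close>
  have "poly q t = 0" if "t \<in> {0<..<e / (norm x + 1)}" for t
  proof -
    have "t * norm x \<le> t * (norm x + 1)" using that by (intro mult_left_mono) auto
    also have "\<dots> < e" using that by (simp add: pos_less_divide_eq add_nonneg_pos)
    finally have "norm (t *\<^sub>R x) < e" using that by simp
    then show ?thesis using e(2) q by metis
  qed
  then have "{0<..<e / (norm x + 1)} \<subseteq> {t. poly q t = 0}" by auto
  moreover have "infinite {0<..<e / (norm x + 1)}"
    using e(1) by (simp add: add_nonneg_pos)
  ultimately have "q = 0" using finite_subset poly_roots_finite by blast
  then show ?thesis using q[of 1] by simp
qed

lemma real_polynomial_function_bi_geg:
  assumes "real_polynomial_function s" "real_polynomial_function q"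
  shows "real_polynomial_function (\<lambda>p. bi_geg m k (s p) (q p))"
proof (induction k rule: induct_nat_012)
  case (ge2 k)
  then show ?case
    unfolding bi_geg.simps
    by (intro real_polynomial_function_diff real_polynomial_function.intros(2-4) assms)
qed (use assms real_polynomial_function.intros(2) in auto)

text \<open>Resolves the definite description in \<open>Y_mat\<close>: \<open>bi_geg\<close>
  supplies a polynomial with the prescribed values for
  \<open>\<bar>x\<bar>, \<bar>y\<bar> < 1\<close>, and these values determine it everywhere.\<close>

lemma Y_mat_eq:
  assumes "n \<ge> 3"
  shows "Y_mat n k x y z i j = x ^ i * y ^ j * bi_geg (n - 1) k (z - x * y) ((1 - x\<^sup>2) * (1 - y\<^sup>2))"
proof -
  define f where "f x y z = x ^ i * y ^ j * bi_geg (n - 1) k (z - x * y) ((1 - x\<^sup>2) * (1 - y\<^sup>2))"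
    for x y z :: real
  have proj: "real_polynomial_function (\<lambda>p::real \<times> real \<times> real. fst p)"
    "real_polynomial_function (\<lambda>p::real \<times> real \<times> real. fst (snd p))"
    "real_polynomial_function (\<lambda>p::real \<times> real \<times> real. snd (snd p))"
    by (intro real_polynomial_function.intros(1) bounded_linear_intros)+
  have poly_f: "real_polynomial_function (\<lambda>(x, y, z). f x y z)"
    unfolding f_def case_prod_beta
    by (intro real_polynomial_function.intros(2-4) real_polynomial_function_diff real_polynomial_function_power
        real_polynomial_function_bi_geg proj)
  have f: "f x y z = x ^ i * y ^ j * ((1 - x\<^sup>2) * (1 - y\<^sup>2)) powr (real k / 2)
             * poly (gegenbauer (n - 1) k) ((z - x * y) / sqrt ((1 - x\<^sup>2) * (1 - y\<^sup>2)))"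
    if "\<bar>x\<bar> < 1" "\<bar>y\<bar> < 1" for x y z
  proof -
    define q where "q = (1 - x\<^sup>2) * (1 - y\<^sup>2)"
    have q: "q > 0" using that by (simp add: q_def abs_square_less_1)
    then have "q powr (real k / 2) = sqrt q ^ k"
      by (simp add: powr_half_sqrt[symmetric] powr_realpow[symmetric] powr_powr)
    moreover have "bi_geg (n - 1) k (z - x * y) ((sqrt q)\<^sup>2)
        = sqrt q ^ k * poly (geg_poly (n - 1) k) ((z - x * y) / sqrt q)"
      using q by (intro bi_geg_eq_geg_poly) simp
    moreover have "gegenbauer (n - 1) = geg_poly (n - 1)"
      using assms by (intro gegenbauer_eq_geg_poly) simp
    ultimately show ?thesis using q unfolding f_def q_def[symmetric] by simp
  qed
  have uniq: "f' = f"
    if f': "real_polynomial_function (\<lambda>(x, y, z). f' x y z)"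
      "\<forall>x y z. \<bar>x\<bar> < 1 \<and> \<bar>y\<bar> < 1 \<longrightarrow>
           f' x y z = x ^ i * y ^ j * ((1 - x\<^sup>2) * (1 - y\<^sup>2)) powr (real k / 2)
             * poly (gegenbauer (n - 1) k) ((z - x * y) / sqrt ((1 - x\<^sup>2) * (1 - y\<^sup>2)))"
    for f' :: "real \<Rightarrow> real \<Rightarrow> real \<Rightarrow> real"
  proof -
    define h where "h p = (\<lambda>(x, y, z). f' x y z) p - (\<lambda>(x, y, z). f x y z) p" for p
    have "real_polynomial_function h"
      unfolding h_def by (intro real_polynomial_function_diff f'(1) poly_f)
    \<comment> \<open>The open unit ball lies inside the region where the values are
      prescribed.\<close>
    moreover have "h p = 0" if "norm p < 1" for p
    proof -
      obtain x y z where p: "p = (x, y, z)" by (cases p)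
      have "\<bar>x\<bar> < 1" "norm (y, z) < 1" using that norm_fst_le[of x "(y, z)"] norm_snd_le[of "(y, z)" x]
        unfolding p by auto
      then have "\<bar>y\<bar> < 1" using norm_fst_le[of y z] by auto
      then show ?thesis using f'(2) f \<open>\<bar>x\<bar> < 1\<close> by (simp add: h_def p)
    qed
    ultimately have "h p = 0" for p using real_polynomial_function_eq_0[of h 1] by simp
    from this[of "(x, y, z)" for x y z] have "f' x y z = f x y z" for x y z by (simp add: h_def)
    then show ?thesis by (intro ext)
  qed
  have "(THE f :: real \<Rightarrow> real \<Rightarrow> real \<Rightarrow> real.
        real_polynomial_function (\<lambda>(x, y, z). f x y z) \<and>
        (\<forall>x y z. \<bar>x\<bar> < 1 \<and> \<bar>y\<bar> < 1 \<longrightarrow>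
           f x y z = x ^ i * y ^ j * ((1 - x\<^sup>2) * (1 - y\<^sup>2)) powr (real k / 2)
             * poly (gegenbauer (n - 1) k)
                 ((z - x * y) / sqrt ((1 - x\<^sup>2) * (1 - y\<^sup>2))))) = f"
    using poly_f f uniq by (intro the_equality) blast+
  then show ?thesis by (simp add: Y_mat_def f_def)
qed

section \<open>Positive semidefiniteness on the sphere\<close>

lemma Y_mat_kernel_psd:
  fixes C :: "(real ^ 'n) set" and w :: "real ^ 'n"
  assumes n: "CARD('n) \<ge> 3" and w: "norm w = 1" and C: "C \<subseteq> sphere 0 1" and M: "psd s M"
  shows "(\<Sum>u\<in>C. \<Sum>v\<in>C. mat_inner s M (Y_mat CARD('n) k (u \<bullet> w) (v \<bullet> w) (u \<bullet> v))) \<ge> 0"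
proof -
  let ?H = "{x. w \<bullet> x = 0}"
  have "w \<noteq> 0" using w by auto
  obtain B where B: "B \<subseteq> ?H" "pairwise orthogonal B" "\<And>x. x \<in> B \<Longrightarrow> norm x = 1"
    "independent B" "card B = dim ?H" "span B = ?H"
    using orthonormal_basis_subspace[OF subspace_hyperplane[of w]] by metis
  have fin: "finite B" using B(4) by (rule independent_imp_finite)
  have cardB: "card B = CARD('n) - 1"
    using B(5) dim_hyperplane[OF \<open>w \<noteq> 0\<close>] by simp
  \<comment> \<open>The vectors of an orthonormal basis of the hyperplane orthogonal to
    \<open>w\<close> serve as names of the \<open>n - 1\<close> variables; \<open>co u\<close> holds
    the coordinates of the projection of \<open>u\<close>.\<close>
  interpret variables B by unfold_locales (rule fin)
  define pr where "pr u = u - (u \<bullet> w) *\<^sub>R w" for u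
  define co where "co u = (\<lambda>b. pr u \<bullet> b)" for u
  have ww: "w \<bullet> w = 1" using w by (simp add: dot_square_norm)
  have span: "pr u \<in> span B" for u
    unfolding B(6) pr_def by (simp add: inner_diff_right inner_commute ww)
  have dot_co: "dot (co u) (co v) = u \<bullet> v - (u \<bullet> w) * (v \<bullet> w)" for u v
  proof -
    have "pr u \<bullet> pr v = pr u \<bullet> (\<Sum>b\<in>B. (pr v \<bullet> b) *\<^sub>R b)"
      using orthonormal_basis_expand[OF B(2,3) span fin] by simp
    also have "\<dots> = dot (co u) (co v)"
      by (simp add: dot_def co_def inner_sum_right mult.commute)
    finally show ?thesis
      by (simp add: pr_def inner_diff_left inner_diff_right ww inner_commute algebra_simps)
  qed
  have "0 \<le> (\<Sum>u\<in>C. \<Sum>v\<in>C. \<Sum>i<s. \<Sum>j<s. M i j * ((u \<bullet> w) ^ i * (v \<bullet> w) ^ j *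
      bi_geg (card B) k (dot (co u) (co v)) (dot (co u) (co u) * dot (co v) (co v))))"
    using n cardB by (intro bi_geg_kernel_psd M) auto
  also have "\<dots> = (\<Sum>u\<in>C. \<Sum>v\<in>C. mat_inner s M (Y_mat CARD('n) k (u \<bullet> w) (v \<bullet> w) (u \<bullet> v)))"
  proof (intro sum.cong refl)
    fix u v assume "u \<in> C" "v \<in> C"
    then have "norm u = 1" "norm v = 1" using C by auto
    then have "u \<bullet> u = 1" "v \<bullet> v = 1" by (auto simp: dot_square_norm)
    then show "(\<Sum>i<s. \<Sum>j<s. M i j * ((u \<bullet> w) ^ i * (v \<bullet> w) ^ j *
      bi_geg (card B) k (dot (co u) (co v)) (dot (co u) (co u) * dot (co v) (co v))))
      = mat_inner s M (Y_mat CARD('n) k (u \<bullet> w) (v \<bullet> w) (u \<bullet> v))"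
      unfolding mat_inner_def Y_mat_eq[OF n] cardB dot_co
      by (subst sum.swap) (simp add: power2_eq_square)
  qed
  finally show ?thesis .
qed

section \<open>Lower bound for the sum over triples\<close>

definition sum3 :: "'a set \<Rightarrow> ('a \<Rightarrow> 'a \<Rightarrow> 'a \<Rightarrow> real) \<Rightarrow> real" where
  "sum3 C g = (\<Sum>u\<in>C. \<Sum>v\<in>C. \<Sum>w\<in>C. g u v w)"

lemma sum3_permute:
  shows "sum3 C (\<lambda>u v w. g v u w) = sum3 C g" "sum3 C (\<lambda>u v w. g u w v) = sum3 C g" "sum3 C (\<lambda>u v w. g w v u) = sum3 C g"
    "sum3 C (\<lambda>u v w. g w u v) = sum3 C g" "sum3 C (\<lambda>u v w. g v w u) = sum3 C g"
proof -
  have 1: "sum3 C (\<lambda>u v w. g v u w) = sum3 C g" for g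
    unfolding sum3_def by (rule sum.swap)
  have 2: "sum3 C (\<lambda>u v w. g u w v) = sum3 C g" for g
    unfolding sum3_def by (rule sum.cong[OF refl], rule sum.swap)
  show "sum3 C (\<lambda>u v w. g v u w) = sum3 C g" "sum3 C (\<lambda>u v w. g u w v) = sum3 C g" by (rule 1 2)+
  show 3: "sum3 C (\<lambda>u v w. g w u v) = sum3 C g"
    using 2[of "\<lambda>a b c. g b a c"] 1[of g] by simp
  show "sum3 C (\<lambda>u v w. g v w u) = sum3 C g"
    using 1[of "\<lambda>a b c. g a c b"] 2[of g] by simp
  show "sum3 C (\<lambda>u v w. g w v u) = sum3 C g"
    using 1[of "\<lambda>a b c. g c a b"] 2[of "\<lambda>a b c. g b a c"] 1[of g] by simp
qed

lemma mat_inner_S_mat: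
  "mat_inner s M (S_mat n k x y z) = 1 / 6 *
    (mat_inner s M (Y_mat n k x y z) + mat_inner s M (Y_mat n k x z y) + mat_inner s M (Y_mat n k y x z) +
     mat_inner s M (Y_mat n k y z x) + mat_inner s M (Y_mat n k z x y) + mat_inner s M (Y_mat n k z y x))"
  unfolding mat_inner_def S_mat_def
  by (simp add: sum.distrib sum_distrib_left distrib_left mult_ac)

text \<open>Summed over all triples, the six permuted \<open>Y\<close> terms contribute equally, so
  \<open>S_mat\<close> may be replaced by \<open>Y_mat\<close>. Each \<open>k\<close> then
  contributes a nonnegative amount, and the part \<open>f0 * E0\<close> of \<open>M 0\<close>
  contributes \<open>f0\<close> per triple.\<close>

lemma BV_sum_ge:
  fixes C :: "(real ^ 'n) set"
  assumes n: "CARD('n) \<ge> 3" and C: "C \<subseteq> sphere 0 1" and F: "F \<in> BV CARD('n) f0"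
  shows "(\<Sum>u\<in>C. \<Sum>v\<in>C. \<Sum>w\<in>C. F (u \<bullet> w) (v \<bullet> w) (u \<bullet> v)) \<ge> f0 * real (card C) ^ 3"
proof -
  obtain d M where M: "\<And>k. k \<le> d \<Longrightarrow> psd (d - k + 1) (M k)"
    "psd (d + 1) (\<lambda>i j. M 0 i j - f0 * E0 i j)"
    and F_eq: "\<And>x y z. F x y z = (\<Sum>k\<le>d. mat_inner (d - k + 1) (M k) (S_mat CARD('n) k x y z))"
    using F unfolding BV_def by blast
  define y where "y k u v w = mat_inner (d - k + 1) (M k) (Y_mat CARD('n) k (u \<bullet> w) (v \<bullet> w) (u \<bullet> v))"
    for k and u v w :: "real ^ 'n"
  let ?S = "sum3 C"
  have S_add: "?S (\<lambda>u v w. f u v w + g u v w) = ?S f + ?S g" for f g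
    by (simp add: sum3_def sum.distrib)
  have S_mult: "?S (\<lambda>u v w. c * g u v w) = c * ?S g" for c g
    by (simp add: sum3_def sum_distrib_left)
  \<comment> \<open>Permuting the three inner products amounts to permuting the three
    points.\<close>
  have "mat_inner (d - k + 1) (M k) (S_mat CARD('n) k (u \<bullet> w) (v \<bullet> w) (u \<bullet> v))
      = 1 / 6 * (y k u v w + y k w v u + y k v u w + y k w u v + y k v w u + y k u w v)" for k u v w
    unfolding mat_inner_S_mat y_def by (simp only: inner_commute)
  then have "?S (\<lambda>u v w. F (u \<bullet> w) (v \<bullet> w) (u \<bullet> v))
      = ?S (\<lambda>u v w. \<Sum>k\<le>d. 1 / 6 * (y k u v w + y k w v u + y k v u w + y k w u v + y k v w u + y k u w v))"
    by (simp only: F_eq)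
  also have "\<dots> = (\<Sum>k\<le>d. ?S (\<lambda>u v w. 1 / 6 * (y k u v w + y k w v u + y k v u w + y k w u v + y k v w u + y k u w v)))"
    unfolding sum3_def by (simp only: sum.swap[of _ "{..d}" C])
  also have "\<dots> = (\<Sum>k\<le>d. ?S (y k))"
  proof (rule sum.cong[OF refl])
    fix k
    show "?S (\<lambda>u v w. 1 / 6 * (y k u v w + y k w v u + y k v u w + y k w u v + y k v w u + y k u w v)) = ?S (y k)"
      unfolding S_mult S_add using sum3_permute[of C "y k"] by simp
  qed
  also have "\<dots> = ?S (y 0) + (\<Sum>k\<in>{..d} - {0}. ?S (y k))"
    by (subst sum.remove[of _ 0]) auto
  finally have 1: "?S (\<lambda>u v w. F (u \<bullet> w) (v \<bullet> w) (u \<bullet> v)) = ?S (y 0) + (\<Sum>k\<in>{..d} - {0}. ?S (y k))" .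
  \<comment> \<open>The pole \<open>w\<close> is moved outermost, since the kernel lemma applies for
    each fixed \<open>w\<close>.\<close>
  have outer: "?S g = (\<Sum>w\<in>C. \<Sum>u\<in>C. \<Sum>v\<in>C. g u v w)" for g
    using sum3_permute(5)[of C g] by (simp add: sum3_def)
  have norm1: "norm w = 1" if "w \<in> C" for w using C that by auto
  have "?S (y k) \<ge> 0" if "k \<le> d" for k
    unfolding outer y_def by (intro sum_nonneg Y_mat_kernel_psd n C M(1) that norm1)
  then have 2: "(\<Sum>k\<in>{..d} - {0}. ?S (y k)) \<ge> 0" by (intro sum_nonneg) auto
  have "y 0 u v w = mat_inner (d + 1) (\<lambda>i j. M 0 i j - f0 * E0 i j) (Y_mat CARD('n) 0 (u \<bullet> w) (v \<bullet> w) (u \<bullet> v)) + f0"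
    for u v w
  proof -
    define Y where "Y = Y_mat CARD('n) 0 (u \<bullet> w) (v \<bullet> w) (u \<bullet> v)"
    have "(\<Sum>j<d+1. \<Sum>i<d+1. E0 i j * Y i j) = (\<Sum>j<d+1. if j = 0 then \<Sum>i<d+1. if i = 0 then Y i j else 0 else 0)"
    proof (rule sum.cong[OF refl])
      fix j
      show "(\<Sum>i<d+1. E0 i j * Y i j) = (if j = 0 then \<Sum>i<d+1. if i = 0 then Y i j else 0 else 0)"
        by (cases "j = 0") (auto simp: E0_def intro!: sum.cong simp del: sum.lessThan_Suc sum.delta)
    qed
    also have "\<dots> = Y 0 0" by (simp add: sum.delta)
    \<comment> \<open>For \<open>k = i = j = 0\<close> every factor of the entry is 1.\<close>
    also have "Y 0 0 = 1" by (simp add: Y_def Y_mat_eq[OF n])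
    finally have e: "(\<Sum>j<d+1. \<Sum>i<d+1. f0 * (E0 i j * Y i j)) = f0"
      by (simp only: sum_distrib_left[symmetric] mult_1_right)
    have "y 0 u v w = (\<Sum>j<d+1. \<Sum>i<d+1. (M 0 i j - f0 * E0 i j) * Y i j) + (\<Sum>j<d+1. \<Sum>i<d+1. f0 * (E0 i j * Y i j))"
      unfolding y_def mat_inner_def Y_def[symmetric] sum.distrib[symmetric]
      by (intro sum.cong) (auto simp: left_diff_distrib mult.assoc simp del: sum.lessThan_Suc)
    then show ?thesis unfolding e by (simp add: mat_inner_def Y_def)
  qed
  then have "?S (y 0) = ?S (\<lambda>u v w. mat_inner (d + 1) (\<lambda>i j. M 0 i j - f0 * E0 i j) (Y_mat CARD('n) 0 (u \<bullet> w) (v \<bullet> w) (u \<bullet> v)))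
      + ?S (\<lambda>u v w. f0)"
    unfolding S_add[symmetric] by (intro arg_cong[where f = "sum3 C"] ext)
  moreover have "?S (\<lambda>u v w. mat_inner (d + 1) (\<lambda>i j. M 0 i j - f0 * E0 i j) (Y_mat CARD('n) 0 (u \<bullet> w) (v \<bullet> w) (u \<bullet> v))) \<ge> 0"
    unfolding outer by (intro sum_nonneg Y_mat_kernel_psd n C M(2) norm1)
  moreover have "?S (\<lambda>u v w. f0) = f0 * real (card C) ^ 3"
    by (simp add: sum3_def power3_eq_cube)
  ultimately have "f0 * real (card C) ^ 3 \<le> ?S (\<lambda>u v w. F (u \<bullet> w) (v \<bullet> w) (u \<bullet> v))"
    using 1 2 by linarith
  then show ?thesis by (simp only: sum3_def)
qed

section \<open>Parity, the upper bound for the triple sum, and pair counting\<close>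

text \<open>A new point adds a row and a column, equal by symmetry, and a zero diagonal
  entry.\<close>

lemma even_card_symmetric_pairs:
  assumes "finite C" and sym: "\<And>u v. R u v \<Longrightarrow> R v u" and irr: "\<And>u. u \<in> C \<Longrightarrow> \<not> R u u"
  shows "even (\<Sum>u\<in>C. \<Sum>v\<in>C. if R u v then 1 else 0 :: nat)"
  using assms(1) irr
proof (induction C rule: finite_induct)
  case (insert x C)
  have "(\<Sum>u\<in>C. if R u x then 1 else 0 :: nat) = (\<Sum>v\<in>C. if R x v then 1 else 0)"
    using sym by (intro sum.cong) auto
  then show ?case using insert by (simp add: sum.distrib)
qed simp

text \<open>Each single equality leaves \<open>N^2\<close> triples and the double equality leaves
  \<open>N\<close>, where \<open>N = card C\<close>.\<close>

lemma sum_pair_indicators: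
  assumes C: "finite C"
  shows "(\<Sum>u\<in>C. \<Sum>v\<in>C. \<Sum>w\<in>C. B * ((if u = v then 1 else 0) + (if u = w then 1 else 0) + (if v = w then 1 else 0))
      + D * (if u = v \<and> v = w then 1 else 0)) = 3 * B * (real (card C))\<^sup>2 + D * real (card C)"
proof -
  have "(\<Sum>w\<in>C. if u = v \<and> v = w then 1 else (0::real)) = (if u = v then \<Sum>w\<in>C. if v = w then 1 else 0 else 0)" for u v
    by simp
  then show ?thesis using C
    by (simp only: sum.distrib sum_distrib_left[symmetric] sum_constant) (simp add: power2_eq_square)
qed

text \<open>
  Since \<open>1 \<notin> T\<close>, the bounds for triples with coinciding points all have the shape of the bound for
  distinct points plus a correction by indicators of equalities, so no cases on \<open>N\<close> arise.
\<close>

lemma F_class_sum_le: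
  fixes C :: "(real ^ 'n) set"
  assumes F: "F \<in> F_class n f0 T g B \<theta>" and \<theta>: "0 < \<theta>" "\<theta> \<le> pi" and T: "T \<subseteq> {-1..cos \<theta>}"
    and code: "spherical_code N \<theta> C"
  shows "(\<Sum>u\<in>C. \<Sum>v\<in>C. \<Sum>w\<in>C. F (u \<bullet> w) (v \<bullet> w) (u \<bullet> v))
    \<le> 3 * real N * (\<Sum>u\<in>C. \<Sum>v\<in>C. extend_zero T g (u \<bullet> v)) + real N * (F 1 1 1 + 3 * (real N - 1) * B)"
proof -
  define e where "e u v = extend_zero T g (u \<bullet> v)" for u v :: "real ^ 'n"
  have C: "finite C" "card C = N" "C \<subseteq> sphere 0 1"
    and sep: "\<And>u v. u \<in> C \<Longrightarrow> v \<in> C \<Longrightarrow> u \<noteq> v \<Longrightarrow> u \<bullet> v \<le> cos \<theta>"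
    using code by (auto simp: spherical_code_def)
  have "cos \<theta> < 1" using cos_monotone_0_pi[of 0 \<theta>] \<theta> by simp
  then have T1: "1 \<notin> T" using T by auto
  have uu: "u \<bullet> u = 1" if "u \<in> C" for u using C(3) that by (auto simp: dot_square_norm)
  have euu: "e u u = 0" if "u \<in> C" for u using uu[OF that] T1 by (simp add: e_def extend_zero_def)
  have e_sym: "e u v = e v u" for u v by (simp add: e_def inner_commute)
  have range: "u \<bullet> v \<in> {-1..cos \<theta>}" if "u \<in> C" "v \<in> C" "u \<noteq> v" for u v
  proof -
    have "norm u = 1" "norm v = 1" using C(3) that by auto
    then have "\<bar>u \<bullet> v\<bar> \<le> 1" using Cauchy_Schwarz_ineq2[of u v] by simp
    then show ?thesis using sep[OF that] by auto
  qed
  have sym: "F x z y = F x y z" "F y x z = F x y z" "F z y x = F x y z" for x y z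
    using F by (auto simp: F_class_def BV_def symmetric_polynomial3_def)
  have F2: "F x x 1 \<le> B + 2 * extend_zero T g x" if "x \<in> {-1..cos \<theta>}" for x
    using F that by (auto simp: F_class_def)
  have F3: "F x y z \<le> extend_zero T g x + extend_zero T g y + extend_zero T g z"
    if "(x, y, z) \<in> D_region \<theta>" for x y z
    using F that by (auto simp: F_class_def)
  \<comment> \<open>Nonnegativity of the Gram determinant: Cauchy-Schwarz for the projections of
    \<open>u\<close> and \<open>v\<close> orthogonal to \<open>w\<close>.\<close>
  have gram: "1 + 2 * (u \<bullet> w) * (v \<bullet> w) * (u \<bullet> v) - (u \<bullet> w)\<^sup>2 - (v \<bullet> w)\<^sup>2 - (u \<bullet> v)\<^sup>2 \<ge> 0"
    if "u \<in> C" "v \<in> C" "w \<in> C" for u v w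
  proof -
    define p q where "p = u - (u \<bullet> w) *\<^sub>R w" and "q = v - (v \<bullet> w) *\<^sub>R w"
    have "p \<bullet> q = u \<bullet> v - (u \<bullet> w) * (v \<bullet> w)" "p \<bullet> p = 1 - (u \<bullet> w)\<^sup>2" "q \<bullet> q = 1 - (v \<bullet> w)\<^sup>2"
      using that uu
      by (simp_all add: p_def q_def inner_diff_left inner_diff_right inner_commute power2_eq_square algebra_simps)
    then have "(u \<bullet> v - (u \<bullet> w) * (v \<bullet> w))\<^sup>2 \<le> (1 - (u \<bullet> w)\<^sup>2) * (1 - (v \<bullet> w)\<^sup>2)"
      using Cauchy_Schwarz_ineq[of p q] by simp
    then show ?thesis by (simp add: power2_eq_square algebra_simps)
  qed
  \<comment> \<open>When all three points coincide the indicators contribute \<open>3 * B\<close>,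
    so this choice makes the correction equal to \<open>F 1 1 1\<close>.\<close>
  let ?D = "F 1 1 1 - 3 * B"
  let ?I = "\<lambda>u v w. B * ((if u = v then 1 else 0) + (if u = w then 1 else 0) + (if v = w then 1 else 0))
      + ?D * (if u = v \<and> v = w then 1 else 0)"
  have pointwise: "F (u \<bullet> w) (v \<bullet> w) (u \<bullet> v) \<le> (e u w + e v w + e u v) + ?I u v w"
    if uvw: "u \<in> C" "v \<in> C" "w \<in> C" for u v w
  proof -
    \<comment> \<open>If exactly two points coincide, one inner product is 1 and the other two are
      equal: the condition on \<open>F x x 1\<close> applies after a permutation, and
      \<open>e\<close> vanishes on the coinciding pair.\<close>
    consider "u = v" "v = w" | "u = v" "v \<noteq> w" | "u = w" "u \<noteq> v" | "v = w" "u \<noteq> v"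
      | "u \<noteq> v" "u \<noteq> w" "v \<noteq> w" by blast
    then show ?thesis
    proof cases
      case 1
      then show ?thesis using uvw by (simp add: uu euu)
    next
      case 2
      then show ?thesis using uvw F2[OF range[of v w]] by (simp add: uu euu) (simp add: e_def)
    next
      case 3
      then show ?thesis using uvw F2[OF range[of v w]] sym(3)[of 1 "v \<bullet> w" "v \<bullet> w"]
        by (simp add: uu euu e_sym[of w v] inner_commute[of w v]) (simp add: e_def)
    next
      case 4
      then show ?thesis using uvw F2[OF range[of u w]] sym(1)[of "u \<bullet> w" 1 "u \<bullet> w"]
        by (simp add: uu euu) (simp add: e_def)
    next
      case 5
      then have "(u \<bullet> w, v \<bullet> w, u \<bullet> v) \<in> D_region \<theta>"
        using range[of u w] range[of v w] range[of u v] gram[OF uvw] uvw by (auto simp: D_region_def)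
      from F3[OF this] show ?thesis using 5 by (simp add: e_def)
    qed
  qed
  define E where "E = (\<Sum>u\<in>C. \<Sum>v\<in>C. e u v)"
  have "(\<Sum>u\<in>C. \<Sum>v\<in>C. \<Sum>w\<in>C. F (u \<bullet> w) (v \<bullet> w) (u \<bullet> v))
    \<le> (\<Sum>u\<in>C. \<Sum>v\<in>C. \<Sum>w\<in>C. (e u w + e v w + e u v) + ?I u v w)"
    by (intro sum_mono pointwise)
  also have "\<dots> = (\<Sum>u\<in>C. \<Sum>v\<in>C. \<Sum>w\<in>C. e u w + e v w + e u v) + (\<Sum>u\<in>C. \<Sum>v\<in>C. \<Sum>w\<in>C. ?I u v w)"
    unfolding sum.distrib[symmetric] by (rule refl)
  also have "(\<Sum>u\<in>C. \<Sum>v\<in>C. \<Sum>w\<in>C. e u w + e v w + e u v) = 3 * real N * E"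
    by (simp add: sum.distrib E_def C(2) sum_distrib_left[symmetric])
  also have "(\<Sum>u\<in>C. \<Sum>v\<in>C. \<Sum>w\<in>C. ?I u v w) = 3 * B * (real N)\<^sup>2 + ?D * real N"
    using sum_pair_indicators[OF C(1), of B ?D] by (simp only: C(2))
  finally show ?thesis
    by (simp add: E_def e_def power2_eq_square algebra_simps)
qed

text \<open>\<open>T\<close> may be infinite, but only the finitely many inner products in
  \<open>V\<close> have nonzero frequency, so the sum over \<open>T \<inter> V\<close> can be
  exchanged with the sums over points.\<close>

lemma dist_distr_set_eq:
  assumes C: "finite C" "C \<noteq> {}"
  shows "real (card C) * dist_distr_set C T = (\<Sum>u\<in>C. \<Sum>v\<in>C. if v \<bullet> u \<in> T then 1 else 0)"
proof -
  define V where "V = (\<lambda>(u, v). v \<bullet> u) ` (C \<times> C)"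
  have V: "finite V" "\<And>u v. u \<in> C \<Longrightarrow> v \<in> C \<Longrightarrow> v \<bullet> u \<in> V"
    using C by (auto simp: V_def)
  have dist: "real (card C) * dist_distr C t = (\<Sum>u\<in>C. \<Sum>v\<in>C. if v \<bullet> u = t then 1 else 0)" for t
    using C by (simp add: dist_distr_def dist_at_def sum.If_cases Collect_conj_eq[symmetric] Int_def)
  have nonneg: "dist_distr C t \<ge> 0" for t
    by (simp add: dist_distr_def sum_nonneg)
  have notV: "dist_distr C t = 0" if "t \<notin> V" for t
  proof -
    have "(\<Sum>u\<in>C. \<Sum>v\<in>C. if v \<bullet> u = t then 1 else 0 :: real) = 0"
      using V(2) that by (intro sum.neutral ballI) auto
    then show ?thesis using dist[of t] C by simp
  qed
  have "dist_distr_set C T = (\<Sum>t\<in>T \<inter> V. dist_distr C t)"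
    unfolding dist_distr_set_def
    by (rule sum.mono_neutral_left) (use V notV nonneg in \<open>auto simp: order_less_le\<close>)
  then have "real (card C) * dist_distr_set C T = (\<Sum>t\<in>T \<inter> V. \<Sum>u\<in>C. \<Sum>v\<in>C. if v \<bullet> u = t then 1 else 0)"
    by (simp add: sum_distrib_left dist)
  also have "\<dots> = (\<Sum>u\<in>C. \<Sum>v\<in>C. \<Sum>t\<in>T \<inter> V. if v \<bullet> u = t then 1 else 0)"
    by (simp only: sum.swap[of _ C "T \<inter> V"])
  also have "\<dots> = (\<Sum>u\<in>C. \<Sum>v\<in>C. if v \<bullet> u \<in> T then 1 else 0)"
    using V by (intro sum.cong refl) (simp add: sum.delta')
  finally show ?thesis .
qed

section \<open>Combination of the two bounds with parity\<close>

theorem corollary1: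
  fixes \<theta> f0 B a :: real
    and T :: "real set"
    and g :: "real \<Rightarrow> real"
    and F :: "real \<Rightarrow> real \<Rightarrow> real \<Rightarrow> real"
    and N :: nat
    and C :: "(real ^ 'n) set"
  assumes "CARD('n) \<ge> 3"
    and "0 < \<theta>" and "\<theta> \<le> pi"
    and "f0 > 0"
    and "T \<subseteq> {-1..cos \<theta>}"
    and "F \<in> F_class CARD('n) f0 T g B \<theta>"
    and "a > 0"
    and "\<And>t. t \<in> T \<Longrightarrow> g t \<le> - a"
    and "spherical_code N \<theta> C"
  shows "let Q = (F 1 1 1 + 3 * (real N - 1) * B - f0 * (real N)\<^sup>2) / (6 * a) in
           dist_distr_set C T \<le> 2 / real N * real_of_int \<lfloor>Q\<rfloor> \<and>
           (\<forall>t. T = {t} \<and> Q < 1 \<longrightarrow> dist_distr C t = 0)"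
proof -
  define Q where "Q = (F 1 1 1 + 3 * (real N - 1) * B - f0 * (real N)\<^sup>2) / (6 * a)"
  have C: "finite C" "card C = N" "C \<subseteq> sphere 0 1" "N \<ge> 1" "C \<noteq> {}"
    using assms(9) by (auto simp: spherical_code_def)
  have "cos \<theta> < 1" using cos_monotone_0_pi[of 0 \<theta>] assms by simp
  then have T1: "1 \<notin> T" using assms(5) by auto
  define P where "P = (\<Sum>u\<in>C. \<Sum>v\<in>C. if v \<bullet> u \<in> T then 1 else 0 :: nat)"
  have P: "real N * dist_distr_set C T = real P"
    using dist_distr_set_eq[OF C(1,5), of T] by (simp add: P_def C(2) if_distrib of_nat_sum cong: if_cong)
  have "even P"
    unfolding P_def
  proof (rule even_card_symmetric_pairs[OF C(1)])
    fix u assume "u \<in> C"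
    then have "u \<bullet> u = 1" using C(3) by (auto simp: dot_square_norm)
    then show "\<not> u \<bullet> u \<in> T" using T1 by simp
  qed (simp add: inner_commute)
  \<comment> \<open>\<open>K\<close> counts unordered pairs; its integrality is what permits the
    floor, and \<open>P = 2 * K\<close> turns the factor 3 into the 6 in \<open>Q\<close>.\<close>
  then obtain K where K: "P = 2 * K" by blast
  define E where "E = (\<Sum>u\<in>C. \<Sum>v\<in>C. extend_zero T g (u \<bullet> v))"
  \<comment> \<open>Every pair with inner product in \<open>T\<close> contributes at most
    \<open>- a\<close>, every other pair 0.\<close>
  have "E \<le> (\<Sum>u\<in>C. \<Sum>v\<in>C. - a * (if v \<bullet> u \<in> T then 1 else 0))"
    unfolding E_def using assms(8) by (intro sum_mono) (auto simp: extend_zero_def inner_commute)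
  also have "\<dots> = - a * real P"
    unfolding P_def of_nat_sum sum_distrib_left by (intro sum.cong refl) auto
  finally have E: "E \<le> - a * real P" .
  have "f0 * real N ^ 3 \<le> (\<Sum>u\<in>C. \<Sum>v\<in>C. \<Sum>w\<in>C. F (u \<bullet> w) (v \<bullet> w) (u \<bullet> v))"
    using BV_sum_ge[OF assms(1) C(3), of F f0] assms(6) C(2) by (simp add: F_class_def)
  also have "\<dots> \<le> 3 * real N * E + real N * (F 1 1 1 + 3 * (real N - 1) * B)"
    unfolding E_def by (rule F_class_sum_le[OF assms(6,2,3,5,9)])
  finally have "real N * (f0 * (real N)\<^sup>2) \<le> real N * (3 * E + (F 1 1 1 + 3 * (real N - 1) * B))"
    by (simp add: power2_eq_square power3_eq_cube algebra_simps)
  then have "f0 * (real N)\<^sup>2 \<le> 3 * E + (F 1 1 1 + 3 * (real N - 1) * B)"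
    using C(4) by simp
  then have "3 * a * real P \<le> F 1 1 1 + 3 * (real N - 1) * B - f0 * (real N)\<^sup>2"
    using E by simp
  then have "real K \<le> Q"
    using assms(7) by (simp add: Q_def K pos_le_divide_eq mult_ac)
  then have "real K \<le> real_of_int \<lfloor>Q\<rfloor>"
    by (metis le_floor_iff of_int_le_iff of_int_of_nat_eq)
  moreover have "dist_distr_set C T = 2 / real N * real K"
    using P C(4) by (simp add: K field_simps)
  ultimately have 1: "dist_distr_set C T \<le> 2 / real N * real_of_int \<lfloor>Q\<rfloor>"
    by (simp add: divide_right_mono)
  have "dist_distr C t = 0" if "T = {t}" "Q < 1" for t
  proof (rule ccontr)
    assume nz: "dist_distr C t \<noteq> 0"
    have "dist_distr C t \<ge> 0" by (simp add: dist_distr_def sum_nonneg)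
    then have "{s \<in> T. dist_distr C s > 0} = {t}" using nz that(1) by auto
    then have "dist_distr_set C T = dist_distr C t" by (simp add: dist_distr_set_def)
    \<comment> \<open>A nonpositive floor bounds the nonnegative frequency above by 0.\<close>
    moreover have "\<lfloor>Q\<rfloor> \<le> 0" using that(2) by linarith
    then have "2 / real N * real_of_int \<lfloor>Q\<rfloor> \<le> 0" by (intro mult_nonneg_nonpos) auto
    ultimately show False using 1 nz \<open>dist_distr C t \<ge> 0\<close> by simp
  qed
  then show ?thesis using 1 unfolding Let_def Q_def[symmetric] by blast
qed

end
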